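(* Let $n\ge 1$ and let $a(s)=s^n+a_1s^{n-1}+\cdots+a_n$ and $b(s)=s^n+b_1s^{n-1}+\cdots+b_n$ be real polynomials of degree $n$ that are both Hurwitz stable. Then there exists a real polynomial $c(s)$ such that $c(s)/a(s)$ and $c(s)/b(s)$ are both strictly positive real if and only if $\lambda b(s)+(1-\lambda)a(s)$ is Hurwitz stable (of degree $n$) for every $\lambda\in[0,1]$.
   Context: A real polynomial is Hurwitz stable if all its roots lie in the open left half-plane $\mathrm{Re}[s]<0$. A rational function $f(s)=p(s)/q(s)$ with $p,q$ real polynomials is called strictly positive real (SPR) if (i) $\deg p=\deg q$; (ii) $q$ is Hurwitz stable (so $f$ is analytic in $\mathrm{Re}[s]\ge 0$); (iii) $\mathrm{Re}[f(j\omega)]>0$ for all $\omega\in\mathbb{R}$, where $j=\sqrt{-1}$. *)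

theory Defs
  imports "HOL-Analysis.Analysis" "HOL-Computational_Algebra.Polynomial"
begin

text \<open>A real polynomial is Hurwitz stable if all its (complex) roots lie in Re s < 0.
  The zero polynomial has every complex number as a root, so it is not Hurwitz stable.\<close>
definition hurwitz_stable :: "real poly \<Rightarrow> bool" where
  "hurwitz_stable p \<longleftrightarrow> (\<forall>z::complex. poly (map_poly complex_of_real p) z = 0 \<longrightarrow> Re z < 0)"

definition SPR :: "real poly \<Rightarrow> real poly \<Rightarrow> bool" where
  "SPR p q \<longleftrightarrow> degree p = degree q \<and> hurwitz_stable q \<and>
     (\<forall>w::real. Re (poly (map_poly complex_of_real p) (\<i> * complex_of_real w) /
                     poly (map_poly complex_of_real q) (\<i> * complex_of_real w)) > 0)"

end

theory Submission
  imports Defs "HOL-Computational_Algebra.Fundamental_Theorem_Algebra"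
    "HOL-Computational_Algebra.Polynomial_Factorial" "HOL-Computational_Algebra.Field_as_Ring"
begin

text \<open>
  Multiplying by \<open>|a|\<^sup>2\<close>, strict positive realness of \<open>c/a\<close> says \<open>Re (c conj a) > 0\<close> on the imaginary
  axis, which is linear in \<open>a\<close> and in \<open>c\<close>. Linearity in \<open>a\<close> gives necessity: no member of the
  segment vanishes on the axis, so along the segment no root leaves the left half-plane.

  For sufficiency, let \<open>b\<^sub>l = l b + (1 - l) a\<close>. The set of \<open>l\<close> in \<open>[0, 1]\<close> for which \<open>a\<close> and \<open>b\<^sub>l\<close> have
  a common strict \<open>c\<close> contains \<open>0\<close> (take \<open>c = a\<close>) and is open. It is closed because a nonzero limit
  \<open>c\<close> of normalised solutions, which only satisfies the weak inequalities, can be perturbed to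
  \<open>c + e d\<close> satisfying the strict ones. The direction \<open>d\<close> has to point inwards at the frequencies where
  \<open>Re (c conj a)\<close> or \<open>Re (c conj b\<^sub>l)\<close> vanishes. As \<open>Re (c/a) \<ge> 0\<close> in the right half-plane, \<open>c = g h\<close>
  with \<open>g\<close> collecting simple zeros on the axis and \<open>h\<close> Hurwitz stable. At the zeros of \<open>g\<close> the value of \<open>d\<close> is
  free, and stability of the segment says that \<open>a\<close> and \<open>b\<^sub>l\<close> do not point in opposite directions
  there. The remaining zeros are double zeros of nonnegative polynomials, so there are at
  most \<open>deg h\<close> of them, and \<open>Im (d\<^sub>1 conj h)\<close> can be prescribed at \<open>deg h\<close> positive frequencies by a
  \<open>d\<^sub>1\<close> of degree at most \<open>deg h\<close>.
\<close>

section \<open>Roots in the left half-plane\<close>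

text \<open>The distance from \<open>s\<close> to \<open>r\<close> is at least
  \<open>- Re r\<close>, the distance of \<open>r\<close> to the axis, so a fixed multiple of
  \<open>norm (s - r)\<close> absorbs the constant \<open>1 + norm r\<close> left by the triangle
  inequality.\<close>

lemma norm_linear_factor_ge:
  fixes r s :: complex
  assumes "Re r < 0" "Re s \<ge> 0"
  shows "1 + norm s \<le> ((1 + norm r) / (- Re r) + 1) * norm (s - r)"
proof -
  have 1: "- Re r \<le> norm (s - r)"
    using abs_Re_le_cmod[of "s - r"] assms by simp
  have "1 + norm s \<le> (1 + norm r) + norm (s - r)"
    using norm_triangle_sub[of s r] by (simp add: norm_minus_commute)
  also have "1 + norm r = (1 + norm r) / (- Re r) * (- Re r)"
    using assms by simp
  also have "\<dots> \<le> (1 + norm r) / (- Re r) * norm (s - r)"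
    using 1 assms by (intro mult_left_mono divide_nonneg_pos) auto
  finally show ?thesis by (simp add: algebra_simps)
qed

text \<open>Both bounds multiply up over the linear factors of \<open>p\<close>. The first dominates
  every small perturbation of degree at most \<open>degree p\<close>; the second is weaker, but its
  constant is the leading coefficient, so it passes to limits of polynomials.\<close>

lemma poly_left_half_plane_lower_bounds:
  fixes p :: "complex poly"
  assumes "\<And>z. poly p z = 0 \<Longrightarrow> Re z < 0"
  shows "\<exists>k>0. \<forall>s. Re s \<ge> 0 \<longrightarrow> k * (1 + norm s) ^ degree p \<le> norm (poly p s)"
    and "\<forall>s. Re s \<ge> 0 \<longrightarrow> norm (lead_coeff p) * (Re s) ^ degree p \<le> norm (poly p s)"
proof -
  have "(\<exists>k>0. \<forall>s. Re s \<ge> 0 \<longrightarrow> k * (1 + norm s) ^ degree p \<le> norm (poly p s)) \<and>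
    (\<forall>s. Re s \<ge> 0 \<longrightarrow> norm (lead_coeff p) * (Re s) ^ degree p \<le> norm (poly p s))"
    using assms
  proof (induction "degree p" arbitrary: p)
    case 0
    then obtain c where c: "p = [:c:]" by (metis degree_eq_zeroE)
    have "c \<noteq> 0" using 0(2)[of 0] c by auto
    then show ?case unfolding c by (auto intro!: exI[of _ "norm c"])
  next
    case (Suc n)
    then have "\<not> constant (poly p)" by (simp add: constant_degree)
    then obtain r where r: "poly p r = 0" using fundamental_theorem_of_algebra by blast
    then obtain q where q: "p = [:-r, 1:] * q" by (auto simp: poly_eq_0_iff_dvd elim: dvdE)
    have "p \<noteq> 0" using Suc(2) by auto
    then have "q \<noteq> 0" using q by auto
    have deg: "degree p = Suc (degree q)"
      unfolding q using \<open>q \<noteq> 0\<close> by (subst degree_mult_eq) auto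
    have Rr: "Re r < 0" using Suc.prems r by blast
    have rq: "poly q z = 0 \<Longrightarrow> Re z < 0" for z using Suc.prems[of z] by (simp add: q)
    have IH: "(\<exists>k>0. \<forall>s. Re s \<ge> 0 \<longrightarrow> k * (1 + norm s) ^ degree q \<le> norm (poly q s))"
      "(\<forall>s. Re s \<ge> 0 \<longrightarrow> norm (lead_coeff q) * (Re s) ^ degree q \<le> norm (poly q s))"
      using Suc.hyps(1)[of q] Suc.hyps(2) deg rq by auto
    from IH(1) obtain k where k: "k > 0"
      "\<And>s. Re s \<ge> 0 \<Longrightarrow> k * (1 + norm s) ^ degree q \<le> norm (poly q s)" by blast
    define m where "m = (1 + norm r) / (- Re r) + 1"
    have m: "m > 0" unfolding m_def using Rr by (intro add_nonneg_pos divide_nonneg_pos) auto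
    have ps: "norm (poly p s) = norm (s - r) * norm (poly q s)" for s
    proof -
      have "poly p s = (s - r) * poly q s" by (simp add: q algebra_simps)
      then show ?thesis by (simp add: norm_mult)
    qed
    have A: "k / m * (1 + norm s) ^ degree p \<le> norm (poly p s)" if s: "Re s \<ge> 0" for s
    proof -
      have "1 + norm s \<le> m * norm (s - r)"
        unfolding m_def by (rule norm_linear_factor_ge[OF Rr s])
      then have "(1 + norm s) / m \<le> norm (s - r)"
        using m by (simp add: pos_divide_le_eq mult.commute)
      then have "(1 + norm s) / m * (k * (1 + norm s) ^ degree q) \<le> norm (s - r) * norm (poly q s)"
        using k(1) k(2)[OF s] m by (intro mult_mono) auto
      then show ?thesis by (simp add: ps deg field_simps)
    qed
    have B: "norm (lead_coeff p) * (Re s) ^ degree p \<le> norm (poly p s)" if s: "Re s \<ge> 0" for s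
    proof -
      have "Re s \<le> norm (s - r)"
        using abs_Re_le_cmod[of "s - r"] Rr s by simp
      moreover have "norm (lead_coeff q) * (Re s) ^ degree q \<le> norm (poly q s)"
        using IH(2) s by blast
      ultimately have "Re s * (norm (lead_coeff q) * (Re s) ^ degree q) \<le> norm (s - r) * norm (poly q s)"
        using s by (intro mult_mono) auto
      moreover have "lead_coeff p = lead_coeff q"
        unfolding q by (subst lead_coeff_mult) simp
      ultimately show ?thesis using deg by (simp add: ps mult_ac)
    qed
    show ?case using A B k(1) m by (intro conjI exI[of _ "k / m"]) auto
  qed
  then show "\<exists>k>0. \<forall>s. Re s \<ge> 0 \<longrightarrow> k * (1 + norm s) ^ degree p \<le> norm (poly p s)"
    and "\<forall>s. Re s \<ge> 0 \<longrightarrow> norm (lead_coeff p) * (Re s) ^ degree p \<le> norm (poly p s)"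
    by blast+
qed

lemma norm_poly_upper_bound:
  fixes p :: "complex poly"
  assumes "degree p \<le> n"
  shows "\<exists>K>0. \<forall>s. norm (poly p s) \<le> K * (1 + norm s) ^ n"
proof -
  \<comment> \<open>The summand 1 keeps \<open>K\<close> positive for the zero polynomial.\<close>
  define K where "K = (\<Sum>i\<le>degree p. norm (coeff p i)) + 1"
  have "norm (poly p s) \<le> K * (1 + norm s) ^ n" for s
  proof -
    have "norm (poly p s) \<le> (\<Sum>i\<le>degree p. norm (coeff p i * s ^ i))"
      unfolding poly_altdef by (rule norm_sum)
    also have "\<dots> \<le> (\<Sum>i\<le>degree p. norm (coeff p i) * (1 + norm s) ^ n)"
    proof (intro sum_mono)
      fix i assume "i \<in> {..degree p}"
      then have i: "i \<le> n" using assms by auto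
      have "norm s ^ i \<le> (1 + norm s) ^ i" by (intro power_mono) auto
      also have "\<dots> \<le> (1 + norm s) ^ n" using i by (intro power_increasing) auto
      finally show "norm (coeff p i * s ^ i) \<le> norm (coeff p i) * (1 + norm s) ^ n"
        by (simp add: norm_mult norm_power mult_left_mono)
    qed
    also have "\<dots> \<le> K * (1 + norm s) ^ n"
      by (simp add: K_def sum_distrib_right[symmetric] algebra_simps)
    finally show ?thesis .
  qed
  moreover have "K > 0" unfolding K_def by (intro add_nonneg_pos sum_nonneg) auto
  ultimately show ?thesis by blast
qed

text \<open>The parameters \<open>t\<close> whose polynomial has all roots in the left half-plane
  form a clopen subset of the unit interval. The condition on the \<open>n\<close>-th coefficients
  keeps roots from escaping to infinity, and the condition on the axis keeps them from crossing
  it.\<close>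

lemma left_half_plane_roots_homotopy:
  fixes p q :: "complex poly"
  assumes deg: "degree p \<le> n" "degree q \<le> n"
    and lc: "\<And>t. 0 \<le> t \<Longrightarrow> t \<le> 1 \<Longrightarrow>
               (1 - of_real t) * coeff p n + of_real t * coeff q n \<noteq> 0"
    and axis: "\<And>t z. 0 \<le> t \<Longrightarrow> t \<le> 1 \<Longrightarrow> Re z = 0 \<Longrightarrow>
               (1 - of_real t) * poly p z + of_real t * poly q z \<noteq> 0"
    and p: "\<And>z. poly p z = 0 \<Longrightarrow> Re z < 0"
    and z: "poly q z = 0"
  shows "Re z < 0"
proof -
  define P where "P t = smult (1 - of_real t) p + smult (of_real t) q" for t :: real
  have P: "poly (P t) s = (1 - of_real t) * poly p s + of_real t * poly q s" for t s
    by (simp add: P_def)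
  have cP: "coeff (P t) n = (1 - of_real t) * coeff p n + of_real t * coeff q n" for t
    by (simp add: P_def)
  have degP: "degree (P t) = n" if "t \<in> {0..1}" for t
  proof (rule antisym)
    show "degree (P t) \<le> n" unfolding P_def
      by (intro degree_add_le order.trans[OF degree_smult_le] deg)
    show "n \<le> degree (P t)" using lc[of t] that cP[of t] by (intro le_degree) auto
  qed
  have axisP: "poly (P t) s \<noteq> 0" if "t \<in> {0..1}" "Re s = 0" for t s
    using axis[of t s] that by (auto simp: P)
  define S where "S = {t \<in> {0..1}. \<forall>s. poly (P t) s = 0 \<longrightarrow> Re s < 0}"
  have "closed S"
  proof (subst closed_sequential_limits, intro allI impI, elim conjE)
    fix x :: "nat \<Rightarrow> real" and l assume x: "\<forall>m. x m \<in> S" and l: "x \<longlonglongrightarrow> l"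
    have l01: "l \<in> {0..1}"
      using closed_sequentially[of "{0..1::real}" x l] x l by (auto simp: S_def)
    have "Re s < 0" if s0: "poly (P l) s = 0" for s
    proof (rule ccontr)
      assume "\<not> Re s < 0"
      then have s: "Re s > 0" using axisP[OF l01, of s] s0 by fastforce
      \<comment> \<open>The constant here is the \<open>n\<close>-th coefficient, which converges to
        a nonzero limit; hence a root of \<open>P l\<close> with positive real part is
        impossible.\<close>
      have *: "norm (coeff (P (x m)) n) * Re s ^ n \<le> norm (poly (P (x m)) s)" for m
        using poly_left_half_plane_lower_bounds(2)[of "P (x m)"] x degP[of "x m"] s
        by (auto simp: S_def)
      have "(\<lambda>m. norm (coeff (P (x m)) n) * Re s ^ n) \<longlonglongrightarrow> norm (coeff (P l) n) * Re s ^ n"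
        unfolding cP by (intro tendsto_intros l)
      moreover have "(\<lambda>m. norm (poly (P (x m)) s)) \<longlonglongrightarrow> norm (poly (P l) s)"
        unfolding P by (intro tendsto_intros l)
      ultimately have "norm (coeff (P l) n) * Re s ^ n \<le> norm (poly (P l) s)"
        by (rule LIMSEQ_le) (use * in blast)
      moreover have "norm (coeff (P l) n) * Re s ^ n > 0"
        using lc[of l] l01 s by (auto simp: cP)
      ultimately show False using s0 by simp
    qed
    then show "l \<in> S" using l01 by (auto simp: S_def)
  qed
  then have cl: "closedin (top_of_set {0..1}) S"
    by (intro closed_subset) (auto simp: S_def)
  have op: "openin (top_of_set {0..1}) S"
    unfolding openin_contains_ball
  proof (intro conjI ballI)
    show "S \<subseteq> {0..1}" by (auto simp: S_def)
    fix t assume t: "t \<in> S"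
    then have t01: "t \<in> {0..1}" by (auto simp: S_def)
    obtain k where k: "k > 0" "\<And>s. Re s \<ge> 0 \<Longrightarrow> k * (1 + norm s) ^ n \<le> norm (poly (P t) s)"
      using poly_left_half_plane_lower_bounds(1)[of "P t"] t degP[OF t01] by (auto simp: S_def)
    have "degree (q - p) \<le> n" using deg by (intro degree_diff_le)
    then obtain K where K: "K > 0" "\<And>s. norm (poly (q - p) s) \<le> K * (1 + norm s) ^ n"
      using norm_poly_upper_bound by blast
    \<comment> \<open>With radius \<open>k / K\<close> the change \<open>(u - t) (q - p)\<close>
      stays below the lower bound for \<open>P t\<close> on the whole closed right
      half-plane.\<close>
    have "u \<in> S" if u: "u \<in> ball t (k / K) \<inter> {0..1}" for u
    proof -
      have "Re s < 0" if s0: "poly (P u) s = 0" for s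
      proof (rule ccontr)
        assume "\<not> Re s < 0"
        then have s: "Re s \<ge> 0" by simp
        have "poly (P u) s - poly (P t) s = of_real (u - t) * poly (q - p) s"
          by (simp add: P algebra_simps)
        then have "norm (poly (P t) s) = \<bar>u - t\<bar> * norm (poly (q - p) s)"
          using s0 by (metis diff_0 norm_minus_cancel norm_mult norm_of_real)
        also have "\<dots> \<le> \<bar>u - t\<bar> * (K * (1 + norm s) ^ n)"
          using K(2) by (intro mult_left_mono) auto
        also have "\<dots> = \<bar>u - t\<bar> * K * (1 + norm s) ^ n" by simp
        also have "\<dots> < k * (1 + norm s) ^ n"
        proof (intro mult_strict_right_mono)
          show "\<bar>u - t\<bar> * K < k" using u K(1) by (auto simp: dist_real_def field_simps abs_minus_commute)
          show "0 < (1 + norm s) ^ n" by (intro zero_less_power) (simp add: add_pos_nonneg)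
        qed
        finally show False using k(2)[OF s] by simp
      qed
      then show ?thesis using u by (auto simp: S_def)
    qed
    then show "\<exists>e>0. ball t e \<inter> {0..1} \<subseteq> S"
      using k(1) K(1) by (intro exI[of _ "k / K"]) auto
  qed
  have "connected {0..1::real}" by simp
  then have "S = {} \<or> S = {0..1}" using op cl unfolding connected_clopen by blast
  moreover have "0 \<in> S" using p by (auto simp: S_def P)
  ultimately have "1 \<in> S" by auto
  then show ?thesis using z by (auto simp: S_def P)
qed

section \<open>Real polynomials on the imaginary axis\<close>

lemma Re_of_real_mult: "Re (of_real r * z) = r * Re z"
  by simp

definition ceval :: "real poly \<Rightarrow> complex \<Rightarrow> complex" where
  "ceval p z = poly (map_poly complex_of_real p) z"

lemma ceval_0 [simp]: "ceval 0 z = 0"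
  by (simp add: ceval_def)

lemma ceval_pCons [simp]: "ceval (pCons c p) z = of_real c + z * ceval p z"
  by (simp add: ceval_def map_poly_pCons)

lemma ceval_1 [simp]: "ceval 1 z = 1"
  by (simp add: ceval_def)

lemma ceval_add [simp]: "ceval (p + q) z = ceval p z + ceval q z"
proof -
  have "map_poly complex_of_real (p + q) = map_poly of_real p + map_poly of_real q"
    by (simp add: poly_eq_iff coeff_map_poly)
  then show ?thesis by (simp add: ceval_def)
qed

lemma ceval_smult [simp]: "ceval (smult c p) z = of_real c * ceval p z"
  by (simp add: ceval_def map_poly_smult)

lemma ceval_minus [simp]: "ceval (- p) z = - ceval p z"
  using ceval_smult[of "-1" p z] by simp

lemma ceval_diff [simp]: "ceval (p - q) z = ceval p z - ceval q z"
  using ceval_add[of p "- q" z] by simp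

lemma ceval_mult [simp]: "ceval (p * q) z = ceval p z * ceval q z"
  by (induction p) (simp_all add: algebra_simps)

lemma ceval_pcompose [simp]: "ceval (pcompose p q) z = ceval p (ceval q z)"
  by (induction p) (simp_all add: pcompose_pCons)

lemma ceval_of_real: "ceval p (of_real x) = of_real (poly p x)"
  by (induction p) simp_all

lemma ceval_cnj: "ceval p (cnj z) = cnj (ceval p z)"
  by (induction p) simp_all

lemma ceval_altdef:
  "degree p \<le> n \<Longrightarrow> ceval p z = (\<Sum>i\<le>n. of_real (coeff p i) * z ^ i)"
  unfolding ceval_def poly_altdef
  by (auto simp: coeff_map_poly degree_map_poly intro!: le_degree sum.mono_neutral_left)

lemma hurwitz_stable_ceval: "hurwitz_stable p \<longleftrightarrow> (\<forall>z. ceval p z = 0 \<longrightarrow> Re z < 0)"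
  by (simp add: hurwitz_stable_def ceval_def)

lemma eq_0_if_ceval_pos_reals_0: "(\<And>x. x > 0 \<Longrightarrow> ceval p (of_real x) = 0) \<Longrightarrow> p = 0"
proof (rule ccontr)
  assume *: "\<And>x. x > 0 \<Longrightarrow> ceval p (of_real x) = 0" and "p \<noteq> 0"
  then have "finite {x. poly p x = 0}" using poly_roots_finite by blast
  moreover have "{0<..} \<subseteq> {x. poly p x = 0}" using * by (auto simp: ceval_of_real)
  ultimately show False using infinite_Ioi[of "0::real"] finite_subset by blast
qed

section \<open>Real parts on the axis and positive real quotients\<close>

definition axis_re :: "real poly \<Rightarrow> real poly \<Rightarrow> real \<Rightarrow> real" where
  "axis_re c a w = Re (ceval c (\<i> * of_real w) * cnj (ceval a (\<i> * of_real w)))"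

lemma axis_re_add_left: "axis_re (c + d) a w = axis_re c a w + axis_re d a w"
  and axis_re_add_right: "axis_re c (a + b) w = axis_re c a w + axis_re c b w"
  and axis_re_smult_left: "axis_re (smult r c) a w = r * axis_re c a w"
  and axis_re_smult_right: "axis_re c (smult r a) w = r * axis_re c a w"
  by (simp_all add: axis_re_def algebra_simps)

text \<open>A minimum principle for \<open>Re (c/a)\<close>, obtained by homotopy. If
  \<open>c/a\<close> took a value \<open>-e\<close> with \<open>Re e > 0\<close> at
  \<open>s\<close>, then \<open>c + e a\<close> would vanish there. Along \<open>t c + e a\<close>
  the top coefficient \<open>e + t * coeff c n\<close> has positive real part, and so has the
  product with the conjugate of \<open>a\<close> on the axis; thus the roots stay in the left
  half-plane, where those of \<open>e a\<close> lie.\<close>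

lemma nonneg_real_part_right_half_plane:
  assumes a: "hurwitz_stable a" "degree a = n" "lead_coeff a = 1"
    and c: "degree c \<le> n" "coeff c n \<ge> 0" "\<And>w. axis_re c a w \<ge> 0"
    and s: "Re s \<ge> 0"
  shows "Re (ceval c s / ceval a s) \<ge> 0"
proof (rule ccontr)
  assume neg: "\<not> ?thesis"
  define e where "e = - (ceval c s / ceval a s)"
  have e: "Re e > 0" using neg by (simp add: e_def)
  have as: "ceval a s \<noteq> 0" using a s by (auto simp: hurwitz_stable_ceval)
  define p where "p = smult e (map_poly complex_of_real a)"
  define q where "q = map_poly complex_of_real c + p"
  have p_eval: "poly p z = e * ceval a z" for z by (simp add: p_def ceval_def)
  have q_eval: "poly q z = ceval c z + e * ceval a z" for z by (simp add: q_def p_def ceval_def)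
  have dega: "degree (map_poly complex_of_real a) = n"
    using a(2) by (subst degree_map_poly) auto
  have degc: "degree (map_poly complex_of_real c) \<le> n"
    using c(1) by (subst degree_map_poly) auto
  have "e \<noteq> 0" using e by auto
  have "Re s < 0"
  proof (rule left_half_plane_roots_homotopy[of p n q])
    show "degree p \<le> n" using dega by (simp add: p_def)
    then show "degree q \<le> n" unfolding q_def using degc by (intro degree_add_le)
    show "(1 - of_real t) * coeff p n + of_real t * coeff q n \<noteq> 0" if "0 \<le> t" "t \<le> 1" for t
    proof -
      have "(1 - of_real t) * coeff p n + of_real t * coeff q n = e + of_real (t * coeff c n)"
        using a by (simp add: q_def p_def coeff_map_poly algebra_simps)
      moreover have "Re (e + of_real (t * coeff c n)) > 0"
        using e c(2) that by (simp add: add_pos_nonneg)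
      ultimately show ?thesis by force
    qed
    show "(1 - of_real t) * poly p z + of_real t * poly q z \<noteq> 0"
      if t: "0 \<le> t" "t \<le> 1" and z: "Re z = 0" for t z
    proof
      assume eq0: "(1 - of_real t) * poly p z + of_real t * poly q z = 0"
      have zi: "z = \<i> * of_real (Im z)" using z by (simp add: complex_eq_iff)
      have az: "ceval a z \<noteq> 0" using a z by (auto simp: hurwitz_stable_ceval)
      have "0 = Re ((e * ceval a z + of_real t * ceval c z) * cnj (ceval a z))"
        using eq0 by (simp add: p_eval q_eval algebra_simps)
      also have "\<dots> = Re (e * (ceval a z * cnj (ceval a z))) + t * axis_re c a (Im z)"
        unfolding axis_re_def zi[symmetric] by (simp add: algebra_simps)
      also have "\<dots> = Re e * (norm (ceval a z))\<^sup>2 + t * axis_re c a (Im z)"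
        by (subst complex_norm_square[symmetric]) simp
      also have "\<dots> > 0" using e az t c(3) by (intro add_pos_nonneg) auto
      finally show False by simp
    qed
    show "Re z < 0" if "poly p z = 0" for z
      using that \<open>e \<noteq> 0\<close> a by (auto simp: p_eval hurwitz_stable_ceval)
    show "poly q s = 0" using as by (simp add: q_eval e_def)
  qed
  then show False using s by simp
qed

text \<open>Dividing a principal argument by \<open>k \<ge> 2\<close> puts it between
  \<open>-pi/2\<close> and \<open>pi/2\<close>.\<close>

lemma root_in_right_half_plane:
  fixes w :: complex
  assumes "w \<noteq> 0" "k \<ge> 2"
  shows "\<exists>z. z ^ k = w \<and> Re z \<ge> 0"
proof -
  define z where "z = exp (Ln w / of_nat k)"
  have "z ^ k = exp (of_nat k * (Ln w / of_nat k))"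
    unfolding z_def by (rule exp_of_nat_mult[symmetric])
  also have "\<dots> = w" using assms by simp
  finally have 1: "z ^ k = w" .
  have "\<bar>Im (Ln w)\<bar> \<le> pi" using Im_Ln_le_pi[OF assms(1)] mpi_less_Im_Ln[OF assms(1)] by simp
  moreover have "pi * 2 \<le> pi * real k" using assms(2) by (intro mult_left_mono) auto
  ultimately have "2 * \<bar>Im (Ln w)\<bar> \<le> pi * real k" by linarith
  then have "\<bar>Im (Ln w / of_nat k)\<bar> \<le> pi / 2"
    using assms(2) by (simp add: field_simps)
  then have "Re z \<ge> 0" unfolding z_def Re_exp
    by (intro mult_nonneg_nonneg cos_ge_zero) (simp_all only: abs_le_iff exp_ge_zero, linarith+)
  with 1 show ?thesis by blast
qed

text \<open>Along a ray the factor \<open>\<rho> ^ k\<close> is positive and can be divided out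
  before \<open>\<rho>\<close> tends to 0.\<close>

lemma nonneg_real_part_leading_term:
  fixes f g :: "complex \<Rightarrow> complex"
  assumes g: "isCont g 0"
    and eq: "\<And>\<rho>::real. \<rho> > 0 \<Longrightarrow> \<rho> < r \<Longrightarrow> f (of_real \<rho> * z) = (of_real \<rho> * z) ^ k * g (of_real \<rho> * z)"
    and pos: "\<And>\<rho>::real. \<rho> > 0 \<Longrightarrow> \<rho> < r \<Longrightarrow> Re (f (of_real \<rho> * z)) \<ge> 0"
    and r: "r > 0"
  shows "Re (z ^ k * g 0) \<ge> 0"
proof -
  have lim: "((\<lambda>\<rho>. of_real \<rho> * z) \<longlongrightarrow> of_real 0 * z) (at_right 0)"
    by (intro tendsto_intros)
  have "((\<lambda>\<rho>. g (of_real \<rho> * z)) \<longlongrightarrow> g 0) (at_right 0)"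
    using isCont_tendsto_compose[OF g] lim by simp
  then have "((\<lambda>\<rho>. Re (z ^ k * g (of_real \<rho> * z))) \<longlongrightarrow> Re (z ^ k * g 0)) (at_right 0)"
    by (intro tendsto_intros)
  moreover have "eventually (\<lambda>\<rho>. Re (z ^ k * g (of_real \<rho> * z)) \<ge> 0) (at_right 0)"
    using eventually_at_right_real[OF r]
  proof eventually_elim
    case (elim \<rho>)
    then have \<rho>: "\<rho> > 0" "\<rho> < r" by auto
    have "f (of_real \<rho> * z) = of_real (\<rho> ^ k) * (z ^ k * g (of_real \<rho> * z))"
      using eq[OF \<rho>] by (simp add: power_mult_distrib mult_ac)
    then have "Re (f (of_real \<rho> * z)) = \<rho> ^ k * Re (z ^ k * g (of_real \<rho> * z))"
      by (simp only: Re_of_real_mult)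
    moreover have "\<rho> ^ k > 0" using \<rho> by simp
    ultimately show ?case using pos[OF \<rho>] by (metis zero_le_mult_iff not_le)
  qed
  ultimately show ?thesis by (rule tendsto_lowerbound) simp
qed

context
  fixes a c :: "real poly"
  assumes a: "hurwitz_stable a"
    and c0: "c \<noteq> 0"
    and pr: "\<And>s. Re s \<ge> 0 \<Longrightarrow> Re (ceval c s / ceval a s) \<ge> 0"
begin

text \<open>Near a zero of order \<open>k\<close> the quotient behaves like
  \<open>g 0 * v ^ k\<close>. At an interior zero every direction \<open>v\<close> is admissible,
  and on the axis those with \<open>Re v \<ge> 0\<close> are; in the first case, and in the second
  once \<open>k \<ge> 2\<close>, some admissible direction makes this leading term equal to
  -1.\<close>

lemma positive_real_zero_order:
  assumes s0: "Re s0 \<ge> 0" and zero: "ceval c s0 = 0"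
  shows "Re s0 = 0" "order s0 (map_poly complex_of_real c) = 1"
proof -
  define C where "C = map_poly complex_of_real c"
  define k where "k = order s0 C"
  have "C \<noteq> 0" using c0 by (simp add: C_def map_poly_eq_0_iff)
  then obtain Q where Q: "C = [:- s0, 1:] ^ k * Q" "\<not> [:- s0, 1:] dvd Q"
    using order_decomp unfolding k_def by blast
  have Q0: "poly Q s0 \<noteq> 0" using Q(2) by (simp add: poly_eq_0_iff_dvd)
  have k1: "k \<ge> 1" using zero \<open>C \<noteq> 0\<close> unfolding k_def C_def ceval_def
    by (simp add: order_root Suc_le_eq)
  define g where "g v = poly Q (s0 + v) / ceval a (s0 + v)" for v
  have as0: "ceval a s0 \<noteq> 0" using a s0 by (auto simp: hurwitz_stable_ceval)
  have g: "isCont g 0" unfolding g_def ceval_def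
    using as0 by (intro continuous_intros) (auto simp: ceval_def)
  have g0: "g 0 \<noteq> 0" using Q0 as0 by (simp add: g_def)
  have cv: "ceval c (s0 + v) / ceval a (s0 + v) = v ^ k * g v" for v
    unfolding g_def ceval_def[of c] C_def[symmetric] Q(1) by simp
  have key: "Re (z ^ k * g 0) \<ge> 0" if "r > 0" "\<And>\<rho>. 0 < \<rho> \<Longrightarrow> \<rho> < r \<Longrightarrow> Re (s0 + of_real \<rho> * z) \<ge> 0" for z r
  proof (rule nonneg_real_part_leading_term[where f = "\<lambda>v. ceval c (s0 + v) / ceval a (s0 + v)" and r = r])
    fix \<rho> :: real assume "0 < \<rho>" "\<rho> < r"
    then show "Re (ceval c (s0 + of_real \<rho> * z) / ceval a (s0 + of_real \<rho> * z)) \<ge> 0"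
      by (intro pr that(2))
  qed (use g cv that(1) in auto)
  show "Re s0 = 0"
  proof (rule ccontr)
    assume "Re s0 \<noteq> 0"
    then have s0': "Re s0 > 0" using s0 by simp
    obtain z where z: "z ^ k = - inverse (g 0)"
      using exists_complex_root[of k "- inverse (g 0)"] k1 by (metis not_one_le_zero)
    have "Re (z ^ k * g 0) \<ge> 0"
    proof (rule key)
      \<comment> \<open>This radius keeps \<open>s0 + \<rho> z\<close> in the right half-plane for
        an arbitrary direction \<open>z\<close>.\<close>
      show "Re s0 / (1 + norm z) > 0" using s0' by (simp add: add_pos_nonneg)
      fix \<rho> assume \<rho>: "0 < \<rho>" "\<rho> < Re s0 / (1 + norm z)"
      then have "\<rho> * (1 + norm z) < Re s0" by (simp add: pos_less_divide_eq add_pos_nonneg)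
      moreover have "\<rho> * Re z \<ge> - (\<rho> * norm z)"
        using \<rho> abs_Re_le_cmod[of z] mult_left_mono[of "- norm z" "Re z" \<rho>] by auto
      ultimately show "Re (s0 + of_real \<rho> * z) \<ge> 0" using \<rho> by (simp add: algebra_simps)
    qed
    then show False using g0 by (simp add: z)
  qed
  show "order s0 (map_poly complex_of_real c) = 1"
  proof (rule ccontr)
    assume "order s0 (map_poly complex_of_real c) \<noteq> 1"
    then have "k \<ge> 2" using k1 by (simp add: k_def C_def)
    then obtain z where z: "z ^ k = - inverse (g 0)" "Re z \<ge> 0"
      using root_in_right_half_plane[of "- inverse (g 0)" k] g0 by auto
    have "Re (z ^ k * g 0) \<ge> 0"
      by (rule key[of 1]) (use s0 z(2) in auto)
    then show False using g0 by (simp add: z)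
  qed
qed

text \<open>The order argument at infinity: inversion preserves the right half-plane, and
  \<open>c/a\<close> at \<open>1/v\<close> has a zero of order \<open>degree a - degree c\<close> at
  \<open>v = 0\<close>. Order 2 or more is excluded as for zeros on the axis.\<close>

lemma positive_real_degree: "degree a \<le> degree c + 1"
proof (rule ccontr)
  assume *: "\<not> ?thesis"
  define k where "k = degree a - degree c"
  have k: "k \<ge> 2" "degree a = degree c + k" using * by (auto simp: k_def)
  have "a \<noteq> 0" using * by auto
  define C where "C = map_poly complex_of_real c"
  define A where "A = map_poly complex_of_real a"
  have dC: "degree C = degree c" "degree A = degree a"
    unfolding C_def A_def by (subst degree_map_poly; simp)+
  have nz: "C \<noteq> 0" "A \<noteq> 0" using c0 \<open>a \<noteq> 0\<close> by (auto simp: C_def A_def map_poly_eq_0_iff)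
  \<comment> \<open>At 0 this is the ratio of the leading coefficients, hence nonzero.\<close>
  define g where "g v = poly (reflect_poly C) v / poly (reflect_poly A) v" for v
  have g: "isCont g 0" unfolding g_def using nz
    by (intro continuous_intros) (auto simp: poly_0_coeff_0)
  have g0: "g 0 \<noteq> 0" using nz by (simp add: g_def poly_0_coeff_0)
  have cv: "ceval c (inverse v) / ceval a (inverse v) = v ^ k * g v" if "v \<noteq> 0" for v
    unfolding g_def ceval_def C_def[symmetric] A_def[symmetric]
    using that by (simp add: poly_reflect_poly_nz dC k(2) power_add)
  obtain z where z: "z ^ k = - inverse (g 0)" "Re z \<ge> 0"
    using root_in_right_half_plane[of "- inverse (g 0)" k] g0 k by auto
  have "z \<noteq> 0" using z(1) g0 k(1) by (auto simp: power_0_left)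
  have "Re (z ^ k * g 0) \<ge> 0"
  proof (rule nonneg_real_part_leading_term[where f = "\<lambda>v. ceval c (inverse v) / ceval a (inverse v)" and r = 1])
    fix \<rho> :: real assume \<rho>: "\<rho> > 0"
    show "ceval c (inverse (of_real \<rho> * z)) / ceval a (inverse (of_real \<rho> * z)) =
        (of_real \<rho> * z) ^ k * g (of_real \<rho> * z)"
      using \<rho> \<open>z \<noteq> 0\<close> by (intro cv) auto
    have "Re (inverse (of_real \<rho> * z)) \<ge> 0"
      using \<rho> z(2) by (simp add: Re_divide inverse_complex.sel)
    then show "Re (ceval c (inverse (of_real \<rho> * z)) / ceval a (inverse (of_real \<rho> * z))) \<ge> 0"
      by (rule pr)
  qed (use g in auto)
  then show False using g0 by (simp add: z)
qed

end

section \<open>Interpolation on the imaginary axis\<close>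

text \<open>A real root is a minimum, so the derivative vanishes there and the root is at least
  double. Removing \<open>(x - r)\<^sup>2\<close> leaves a polynomial that is nonnegative away from
  \<open>r\<close>, and by continuity also at \<open>r\<close>.\<close>

lemma nonneg_poly_card_roots:
  fixes P :: "real poly"
  assumes "P \<noteq> 0" "\<And>x. poly P x \<ge> 0"
  shows "2 * card {x. poly P x = 0} \<le> degree P"
  using assms
proof (induction "degree P" arbitrary: P rule: less_induct)
  case less
  show ?case
  proof (cases "\<exists>r. poly P r = 0")
    case False
    then show ?thesis by simp
  next
    case True
    then obtain r where r: "poly P r = 0" by blast
    then obtain P1 where P1: "P = [:-r, 1:] * P1" by (auto simp: poly_eq_0_iff_dvd elim: dvdE)
    have "DERIV (poly P) r :> poly (pderiv P) r" by (rule poly_DERIV)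
    then have "poly (pderiv P) r = 0"
      by (rule DERIV_local_min[where d = 1]) (use r less.prems in auto)
    then have "poly P1 r = 0" unfolding P1 by (simp add: pderiv_mult pderiv_pCons del: mult_pCons_left)
    then obtain Q where "P1 = [:-r, 1:] * Q" by (auto simp: poly_eq_0_iff_dvd elim: dvdE)
    then have Q: "P = [:-r, 1:] * ([:-r, 1:] * Q)" by (simp only: P1)
    have "Q \<noteq> 0" using less.prems(1) Q by auto
    have deg: "degree P = degree Q + 2"
      unfolding Q using \<open>Q \<noteq> 0\<close> by (simp add: degree_mult_eq del: mult_pCons_left)
    have PQ: "poly P x = (x - r)\<^sup>2 * poly Q x" for x
      unfolding Q by (simp add: power2_eq_square algebra_simps)
    have Qpos: "poly Q x \<ge> 0" if "x \<noteq> r" for x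
      using less.prems(2)[of x] that unfolding PQ by (simp add: zero_le_mult_iff)
    have "poly Q x \<ge> 0" for x
    proof (cases "x = r")
      case True
      have "(poly Q \<longlongrightarrow> poly Q r) (at r)" by (intro tendsto_intros)
      moreover have "eventually (\<lambda>x. poly Q x \<ge> 0) (at r)"
        using Qpos by (auto simp: eventually_at_filter)
      ultimately have "poly Q r \<ge> 0" by (rule tendsto_lowerbound) simp
      then show ?thesis using True by simp
    qed (use Qpos in auto)
    then have IH: "2 * card {x. poly Q x = 0} \<le> degree Q"
      using less.hyps[of Q] deg \<open>Q \<noteq> 0\<close> by auto
    have fin: "finite {x. poly Q x = 0}" using \<open>Q \<noteq> 0\<close> poly_roots_finite by blast
    have "card {x. poly P x = 0} \<le> card (insert r {x. poly Q x = 0})"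
      using fin by (intro card_mono) (auto simp: PQ)
    also have "\<dots> \<le> Suc (card {x. poly Q x = 0})" by (rule card_insert_le_m1) auto
    finally show ?thesis using IH deg by simp
  qed
qed

text \<open>Newton interpolation: each new node is corrected by a multiple of the product vanishing
  at the old nodes. The alternative \<open>q = 0\<close> covers the empty set, for which no degree
  is below the cardinality.\<close>

lemma poly_interpolation_exists:
  fixes S :: "'a::field set"
  assumes "finite S"
  shows "\<exists>q. (q = 0 \<or> degree q < card S) \<and> (\<forall>x\<in>S. poly q x = f x)"
  using assms
proof (induction S rule: finite_induct)
  case empty
  show ?case by (intro exI[of _ 0]) simp
next
  case (insert x S)
  then obtain q where q: "q = 0 \<or> degree q < card S" "\<And>y. y \<in> S \<Longrightarrow> poly q y = f y" by blast
  define m where "m = (\<Prod>y\<in>S. [:-y, 1:])"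
  have m: "degree m = card S" unfolding m_def by (subst degree_prod_eq_sum_degree) auto
  have mx: "poly m x \<noteq> 0" using insert by (auto simp: m_def poly_prod)
  have my: "poly m y = 0" if "y \<in> S" for y using insert that by (auto simp: m_def poly_prod)
  define q' where "q' = q + smult ((f x - poly q x) / poly m x) m"
  have "degree q' \<le> card S" unfolding q'_def
    using q(1) m by (intro degree_add_le order.trans[OF degree_smult_le]) auto
  then have "degree q' < card (insert x S)" using insert.hyps by simp
  then show ?case using insert mx my q(2)
    by (intro exI[of _ q']) (auto simp: q'_def)
qed

text \<open>The roots of \<open>h(s)\<close> and of \<open>h(-s)\<close> lie in opposite open
  half-planes, so a nonconstant common divisor would have a complex root in both.\<close>

lemma hurwitz_coprime_reflection:
  assumes "hurwitz_stable h"
  shows "coprime h (pcompose h [:0, -1:])"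
proof (rule coprimeI)
  fix g assume g: "g dvd h" "g dvd pcompose h [:0, -1:]"
  have "h \<noteq> 0" using assms by (auto simp: hurwitz_stable_ceval dest: spec[of _ 0])
  then have "g \<noteq> 0" using g by auto
  show "is_unit g"
  proof (rule ccontr)
    assume "\<not> is_unit g"
    then have "degree g \<noteq> 0" using \<open>g \<noteq> 0\<close> by (simp add: is_unit_iff_degree)
    then have "\<not> constant (poly (map_poly complex_of_real g))"
      by (subst constant_degree, subst degree_map_poly) auto
    then obtain z where z: "ceval g z = 0"
      using fundamental_theorem_of_algebra unfolding ceval_def by blast
    have "ceval h z = 0" using g(1) z by (auto elim!: dvdE)
    moreover have "ceval (pcompose h [:0, -1:]) z = 0" using g(2) z by (auto elim!: dvdE simp del: ceval_pcompose)
    ultimately have "Re z < 0" "Re (- z) < 0" using assms by (auto simp: hurwitz_stable_ceval)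
    then show False by simp
  qed
qed

text \<open>A Bezout identity for \<open>h(s)\<close> and \<open>h(-s)\<close> writes any polynomial of degree
  below \<open>2 deg h\<close> as \<open>u(s) h(-s) + v(s) h(s)\<close>; on the imaginary axis the imaginary part of
  this expression is that of \<open>(u(s) - v(-s)) h(-s)\<close>.\<close>
lemma hurwitz_axis_im_interpolation:
  assumes h: "hurwitz_stable h" and S: "finite S" "\<And>w. w \<in> S \<Longrightarrow> w > 0" "card S \<le> degree h"
  shows "\<exists>d. degree d \<le> degree h \<and>
    (\<forall>w\<in>S. Im (ceval d (\<i> * of_real w) * cnj (ceval h (\<i> * of_real w))) = f w)"
proof (cases "degree h = 0")
  case True
  then show ?thesis using S by (intro exI[of _ 0]) auto
next
  case False
  \<comment> \<open>The nodes are the squares of \<open>\<i> w\<close>. The odd polynomial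
    \<open>s Q(s\<^sup>2)\<close> takes purely imaginary values on the axis, and dividing the data
    by \<open>w\<close> makes it equal to \<open>\<i> * f w\<close> there; positivity of the
    frequencies keeps the nodes distinct.\<close>
  define S' where "S' = (\<lambda>w. - w\<^sup>2) ` S"
  have "inj_on (\<lambda>w. - w\<^sup>2) S"
  proof (rule inj_onI)
    fix x y assume "x \<in> S" "y \<in> S" "- x\<^sup>2 = - y\<^sup>2"
    then show "x = y" using S(2)[of x] S(2)[of y] by (auto simp: power2_eq_iff)
  qed
  then have card': "card S' = card S" unfolding S'_def by (rule card_image)
  obtain Q where Q: "Q = 0 \<or> degree Q < card S'" "\<forall>x\<in>S'. poly Q x = f (sqrt (- x)) / sqrt (- x)"
    using poly_interpolation_exists[of S' "\<lambda>x. f (sqrt (- x)) / sqrt (- x)"] S(1) by (auto simp: S'_def)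
  have Qw: "poly Q (- w\<^sup>2) = f w / w" if "w \<in> S" for w
    using Q(2) that S(2)[OF that] by (auto simp: S'_def)
  define R where "R = [:0, 1:] * pcompose Q [:0, 0, 1:]"
  have degR: "degree R \<le> 2 * degree h - 1"
  proof -
    have "degree R \<le> 1 + degree (pcompose Q [:0, 0, 1:])" unfolding R_def
      by (rule order.trans[OF degree_mult_le]) simp
    also have "\<dots> \<le> 1 + degree Q * 2"
      using degree_pcompose_le[of Q "[:0, 0, 1:]"] by simp
    finally show ?thesis using Q(1) S(3) card' False by auto
  qed
  have Rw: "ceval R (\<i> * of_real w) = \<i> * of_real (f w)" if "w \<in> S" for w
  proof -
    have "ceval R (\<i> * of_real w) = \<i> * of_real w * ceval Q (of_real (- w\<^sup>2))"
      by (simp add: R_def power2_eq_square algebra_simps)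
    also have "\<dots> = \<i> * of_real w * of_real (f w / w)"
      using Qw[OF that] by (simp add: ceval_of_real del: of_real_minus)
    finally show ?thesis using S(2)[OF that] by simp
  qed
  define h' where "h' = pcompose h [:0, -1:]"
  have degh': "degree h' = degree h" by (simp add: h'_def degree_pcompose)
  have "coprime h h'" unfolding h'_def by (rule hurwitz_coprime_reflection[OF h])
  then obtain x y where xy: "x * h + y * h' = 1"
    using bezout_coefficients_fst_snd[of h h'] by (auto simp: coprime_iff_gcd_eq_1)
  \<comment> \<open>Reducing the first Bezout coefficient modulo \<open>h\<close> bounds
    \<open>degree u\<close>; the bound on \<open>degree v\<close> then follows by comparing degrees
    in \<open>v * h = R - u * h'\<close>.\<close>
  define u where "u = (R * y) mod h"
  define k where "k = (R * y) div h"
  define v where "v = R * x + k * h'"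
  have uv: "R = u * h' + v * h"
  proof -
    have "R = R * (x * h + y * h')" by (simp add: xy)
    also have "\<dots> = R * x * h + (R * y) * h'" by (simp add: algebra_simps)
    also have "R * y = k * h + u" unfolding k_def u_def by (rule div_mult_mod_eq[symmetric])
    also have "R * x * h + (k * h + u) * h' = u * h' + v * h" by (simp add: v_def algebra_simps)
    finally show ?thesis .
  qed
  have "h \<noteq> 0" using False by auto
  then have degu: "degree u < degree h" unfolding u_def
    using False degree_mod_less'[of h "R * y"] by (cases "R * y mod h = 0") auto
  have degv: "degree v < degree h"
  proof (cases "v = 0")
    case False
    have "degree v + degree h = degree (R - u * h')"
      using \<open>h \<noteq> 0\<close> False by (simp add: uv degree_mult_eq)
    also have "\<dots> \<le> 2 * degree h - 1"
      using degR degu degh' by (intro degree_diff_le order.trans[OF degree_mult_le]) auto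
    finally show ?thesis using degu by linarith
  qed (use \<open>degree h \<noteq> 0\<close> in auto)
  define d where "d = u - pcompose v [:0, -1:]"
  have "degree d \<le> degree h" unfolding d_def
    using degu degv by (intro degree_diff_le) (auto simp: degree_pcompose)
  moreover have "Im (ceval d z * cnj (ceval h z)) = f w" if "w \<in> S" and z: "z = \<i> * of_real w" for w z
  proof -
    have refl: "ceval (pcompose p [:0, -1:]) z = cnj (ceval p z)" for p
      using ceval_cnj[of p z] z by simp
    have "Im (ceval d z * cnj (ceval h z)) =
        Im (ceval u z * cnj (ceval h z)) - Im (cnj (ceval v z * ceval h z))"
      unfolding d_def ceval_diff refl by (simp add: algebra_simps)
    also have "\<dots> = Im (ceval R z)"
      unfolding uv ceval_add ceval_mult h'_def refl by simp
    finally show ?thesis using Rw[OF that(1)] by (simp add: z)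
  qed
  ultimately show ?thesis by blast
qed

lemma degree_less_2_imp_pCons:
  fixes r :: "'a::zero poly"
  assumes "degree r < 2"
  shows "\<exists>x y. r = [:x, y:]"
proof (intro exI)
  show "r = [:coeff r 0, coeff r 1:]"
    using assms by (auto simp: poly_eq_iff coeff_pCons coeff_eq_0 split: nat.splits)
qed

lemma ceval_prod [simp]: "ceval (prod f A) z = (\<Prod>x\<in>A. ceval (f x) z)"
  by (induction A rule: infinite_finite_induct) simp_all

text \<open>Distinct positive frequencies give quadratics without common zeros, so the cofactor must
  vanish at the next zero. Its remainder modulo the quadratic is a real linear polynomial vanishing
  at \<open>\<i> w\<close> with \<open>w > 0\<close>, hence zero.\<close>

lemma axis_zeros_prod_dvd:
  assumes "finite A" "\<And>w. w \<in> A \<Longrightarrow> w > 0" "\<And>w. w \<in> A \<Longrightarrow> ceval c (\<i> * of_real w) = 0"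
  shows "(\<Prod>w\<in>A. [:w\<^sup>2, 0, 1:]) dvd c"
  using assms
proof (induction A rule: finite_induct)
  case empty
  show ?case by simp
next
  case (insert w A)
  then obtain q where q: "c = (\<Prod>w\<in>A. [:w\<^sup>2, 0, 1:]) * q" by (auto elim: dvdE)
  have "ceval (\<Prod>w\<in>A. [:w\<^sup>2, 0, 1:]) (\<i> * of_real w) \<noteq> 0"
  proof -
    have "ceval [:x\<^sup>2, 0, 1:] (\<i> * of_real w) \<noteq> 0" if x: "x \<in> A" for x
    proof -
      have "x \<noteq> w" "x > 0" "w > 0" using x insert by auto
      then have "x\<^sup>2 - w\<^sup>2 \<noteq> 0" by (simp add: power2_eq_iff)
      moreover have "ceval [:x\<^sup>2, 0, 1:] (\<i> * of_real w) = of_real (x\<^sup>2 - w\<^sup>2)"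
        by (simp add: power2_eq_square algebra_simps)
      ultimately show ?thesis by (metis of_real_eq_0_iff)
    qed
    then show ?thesis using insert.hyps by (simp del: ceval_pCons)
  qed
  moreover have "ceval c (\<i> * of_real w) = 0" using insert by simp
  ultimately have qw: "ceval q (\<i> * of_real w) = 0" unfolding q by simp
  define r where "r = q mod [:w\<^sup>2, 0, 1:]"
  have qr: "q = q div [:w\<^sup>2, 0, 1:] * [:w\<^sup>2, 0, 1:] + r"
    unfolding r_def by (rule div_mult_mod_eq[symmetric])
  have "degree r < 2" unfolding r_def
    using degree_mod_less'[of "[:w\<^sup>2, 0, 1:]" q] by (cases "q mod [:w\<^sup>2, 0, 1:] = 0") auto
  then obtain x y where xy: "r = [:x, y:]"
    using degree_less_2_imp_pCons by blast
  have "ceval [:w\<^sup>2, 0, 1:] (\<i> * of_real w) = 0" by (simp add: power2_eq_square algebra_simps)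
  then have "ceval r (\<i> * of_real w) = 0" 
    using qw arg_cong[OF qr, of "\<lambda>p. ceval p (\<i> * of_real w)"]
    by (simp only: ceval_add ceval_mult mult_zero_right add_0_left)
  then have "r = 0" using insert.prems(1)[of w] by (simp add: xy complex_eq_iff)
  then have "[:w\<^sup>2, 0, 1:] dvd q" by (simp add: r_def dvd_eq_mod_eq_0)
  then have "[:w\<^sup>2, 0, 1:] * (\<Prod>w\<in>A. [:w\<^sup>2, 0, 1:]) dvd q * (\<Prod>w\<in>A. [:w\<^sup>2, 0, 1:])"
    by (intro mult_dvd_mono) auto
  then show ?case unfolding q
    by (simp only: prod.insert[OF insert.hyps] mult.commute[of q])
qed

section \<open>The real part on the axis as a polynomial\<close>

text \<open>As \<open>a\<close> is real, its conjugate on the axis is \<open>a(-s)\<close>. The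
  product is therefore a real polynomial \<open>F\<close> evaluated at \<open>\<i> w\<close>, and
  taking the real part multiplies the \<open>k\<close>-th coefficient by
  \<open>Re (\<i> ^ k)\<close>.\<close>

definition axis_poly :: "real poly \<Rightarrow> real poly \<Rightarrow> real poly" where
  "axis_poly c a = (let F = c * pcompose a [:0, -1:] in
     (\<Sum>k\<le>degree F. monom (Re (\<i> ^ k) * coeff F k) k))"

lemma coeff_axis_poly:
  "coeff (axis_poly c a) k = Re (\<i> ^ k) * coeff (c * pcompose a [:0, -1:]) k"
  by (auto simp: axis_poly_def Let_def coeff_sum coeff_eq_0)

lemma poly_axis_poly: "poly (axis_poly c a) w = axis_re c a w"
proof -
  define F where "F = c * pcompose a [:0, -1:]"
  define z where "z = \<i> * complex_of_real w"
  have "axis_re c a w = Re (ceval F z)"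
    using ceval_cnj[of a z] by (simp add: axis_re_def F_def z_def)
  also have "\<dots> = (\<Sum>k\<le>degree F. coeff F k * Re (z ^ k))"
    by (subst ceval_altdef[OF order_refl]) simp
  also have "\<dots> = (\<Sum>k\<le>degree F. Re (\<i> ^ k) * coeff F k * w ^ k)"
  proof (intro sum.cong refl)
    fix k
    have "z ^ k = of_real (w ^ k) * \<i> ^ k" by (simp add: z_def power_mult_distrib)
    then have "Re (z ^ k) = w ^ k * Re (\<i> ^ k)"
      by (simp only: Re_of_real_mult)
    then show "coeff F k * Re (z ^ k) = Re (\<i> ^ k) * coeff F k * w ^ k" by simp
  qed
  also have "\<dots> = poly (axis_poly c a) w"
    by (simp add: axis_poly_def Let_def F_def poly_sum poly_monom)
  finally show ?thesis ..
qed

lemma coeff_mult_top: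
  fixes p q :: "'a::comm_semiring_0 poly"
  assumes "degree p \<le> m" "degree q \<le> n"
  shows "coeff (p * q) (m + n) = coeff p m * coeff q n"
proof -
  have "coeff (p * q) (m + n) = (\<Sum>i\<le>m + n. coeff p i * coeff q (m + n - i))"
    by (rule coeff_mult)
  also have "\<dots> = (\<Sum>i\<in>{m}. coeff p i * coeff q (m + n - i))"
  proof (intro sum.mono_neutral_right ballI)
    fix i assume i: "i \<in> {..m + n} - {m}"
    then consider "i > m" | "m + n - i > n" by fastforce
    then show "coeff p i * coeff q (m + n - i) = 0"
      using assms by cases (simp_all add: coeff_eq_0)
  qed auto
  finally show ?thesis by simp
qed

text \<open>The sign \<open>(-1) ^ n\<close> from \<open>a(-s)\<close> cancels against
  \<open>\<i> ^ (2 * n)\<close>. This ties the behaviour at infinite frequency to the coefficient of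
  \<open>c\<close> at \<open>n\<close>, which may be 0.\<close>

lemma coeff_axis_poly_top:
  assumes "degree c \<le> n" "degree a \<le> n"
  shows "coeff (axis_poly c a) (2 * n) = coeff c n * coeff a n"
proof -
  have "degree (pcompose a [:0, -1:]) \<le> n" using assms(2) by (simp add: degree_pcompose)
  then have "coeff (c * pcompose a [:0, -1:]) (n + n) = coeff c n * ((- 1) ^ n * coeff a n)"
    using assms(1) by (subst coeff_mult_top) (auto simp: coeff_pcompose_linear)
  moreover have "\<i> ^ (2 * n) = of_real ((- 1) ^ n)" by (simp add: power_mult)
  then have "Re (\<i> ^ (2 * n)) = (- 1) ^ n" by (simp only: Re_complex_of_real)
  moreover have "(- 1) ^ n * (- 1) ^ n = (1 :: real)" by (simp flip: power_mult_distrib)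
  ultimately show ?thesis by (simp add: coeff_axis_poly mult_2 flip: mult.assoc)
qed

text \<open>The product may reach the odd degree \<open>2 * degree c + 1\<close>, but there the
  power of \<open>\<i>\<close> is purely imaginary and the coefficient disappears.\<close>

lemma degree_axis_poly_le:
  assumes "degree a \<le> degree c + 1"
  shows "degree (axis_poly c a) \<le> 2 * degree c"
proof (rule degree_le, intro allI impI)
  fix k assume k: "2 * degree c < k"
  have "degree (c * pcompose a [:0, -1:]) \<le> degree c + degree a"
    by (rule order.trans[OF degree_mult_le]) (simp add: degree_pcompose)
  show "coeff (axis_poly c a) k = 0"
  proof (cases "k = 2 * degree c + 1")
    case True
    have "\<i> ^ k = \<i> * of_real ((- 1) ^ degree c)" by (simp add: True power_mult)
    then have "Re (\<i> ^ k) = 0" by (simp only: Re_i_times Im_complex_of_real)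
    then show ?thesis by (simp add: coeff_axis_poly)
  next
    case False
    then have "degree (c * pcompose a [:0, -1:]) < k"
      using k assms \<open>degree (c * pcompose a [:0, -1:]) \<le> degree c + degree a\<close> by linarith
    then show ?thesis by (simp add: coeff_axis_poly coeff_eq_0)
  qed
qed

lemma degree_axis_poly_le':
  assumes "degree c \<le> n" "degree a \<le> n"
  shows "degree (axis_poly c a) \<le> 2 * n"
proof (rule degree_le, intro allI impI)
  fix k assume "2 * n < k"
  moreover have "degree (c * pcompose a [:0, -1:]) \<le> 2 * n"
    using assms by (intro order.trans[OF degree_mult_le]) (simp add: degree_pcompose)
  ultimately show "coeff (axis_poly c a) k = 0" by (simp add: coeff_axis_poly coeff_eq_0)
qed

lemma axis_re_minus_arg: "axis_re c a (- w) = axis_re c a w"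
proof -
  have "\<i> * complex_of_real (- w) = cnj (\<i> * complex_of_real w)" by simp
  then show ?thesis unfolding axis_re_def by (simp only: ceval_cnj) simp
qed

section \<open>Perturbation and compactness arguments\<close>

lemma compact_perturbation_pos:
  fixes f g :: "'a::metric_space \<Rightarrow> real"
  assumes K: "compact K" and f: "continuous_on K f" and g: "continuous_on K g"
    and f0: "\<And>x. x \<in> K \<Longrightarrow> f x \<ge> 0" and g0: "\<And>x. x \<in> K \<Longrightarrow> f x = 0 \<Longrightarrow> g x > 0"
  shows "\<exists>e0>0. \<forall>e. 0 < e \<and> e < e0 \<longrightarrow> (\<forall>x\<in>K. f x + e * g x > 0)"
proof -
  \<comment> \<open>Outside \<open>K0\<close> every positive \<open>e\<close> works. On the compact
    set \<open>K0\<close> the function \<open>f\<close> is positive, hence bounded away from 0,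
    while \<open>g\<close> is bounded below.\<close>
  define K0 where "K0 = {x \<in> K. g x \<le> 0}"
  have pos: "f x + e * g x > 0" if "x \<in> K" "x \<notin> K0" "e > 0" for x e
    using that f0[of x] by (auto simp: K0_def intro: add_nonneg_pos)
  have "compact K0"
  proof -
    have "closedin (top_of_set K) (K \<inter> g -` {..0})"
      using g by (intro continuous_closedin_preimage) auto
    then have "compact (K \<inter> g -` {..0})" using K by (rule closedin_compact[rotated])
    moreover have "K0 = K \<inter> g -` {..0}" by (auto simp: K0_def)
    ultimately show ?thesis by simp
  qed
  show ?thesis
  proof (cases "K0 = {}")
    case True
    then show ?thesis using pos by (intro exI[of _ 1]) auto
  next
    case False
    have sub: "K0 \<subseteq> K" by (auto simp: K0_def)
    obtain x0 where x0: "x0 \<in> K0" "\<And>x. x \<in> K0 \<Longrightarrow> f x0 \<le> f x"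
      using continuous_attains_inf[OF \<open>compact K0\<close> False continuous_on_subset[OF f sub]] by blast
    obtain x1 where x1: "x1 \<in> K0" "\<And>x. x \<in> K0 \<Longrightarrow> g x1 \<le> g x"
      using continuous_attains_inf[OF \<open>compact K0\<close> False continuous_on_subset[OF g sub]] by blast
    have fx0: "f x0 > 0" using f0[of x0] g0[of x0] x0(1) by (force simp: K0_def)
    \<comment> \<open>As the minimum \<open>g x1\<close> is at most 0, this gives
      \<open>B \<ge> 1\<close> and \<open>- B\<close> below \<open>g\<close> on
      \<open>K0\<close>.\<close>
    define B where "B = 1 - g x1"
    have B: "B > 0" using x1(1) by (simp add: B_def K0_def)
    have "f x + e * g x > 0" if e: "0 < e" "e < f x0 / B" and x: "x \<in> K" for e x
    proof (cases "x \<in> K0")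
      case True
      have "e * B < f x0" using e B by (simp add: field_simps)
      moreover have "e * g x \<ge> e * (- B)" using e x1(2)[OF True] by (intro mult_left_mono) (auto simp: B_def)
      ultimately show ?thesis using x0(2)[OF True] by simp
    qed (use pos x e in auto)
    then show ?thesis using fx0 B by (intro exI[of _ "f x0 / B"]) auto
  qed
qed

text \<open>Homogenising the polynomials makes the point at infinity, where the leading coefficient is
  read off, an ordinary point of the compact unit circle.\<close>
lemma poly_perturbation_pos:
  fixes P D :: "real poly"
  assumes deg: "degree P \<le> N" "degree D \<le> N" and "even N"
    and P: "\<And>x. poly P x \<ge> 0" "coeff P N \<ge> 0"
    and D: "\<And>x. poly P x = 0 \<Longrightarrow> poly D x > 0" "coeff P N = 0 \<Longrightarrow> coeff D N > 0"
  shows "\<exists>e0>0. \<forall>e. 0 < e \<and> e < e0 \<longrightarrow>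
    coeff P N + e * coeff D N > 0 \<and> (\<forall>x. poly P x + e * poly D x > 0)"
proof -
  define H where "H p v = (\<Sum>i\<le>N. coeff p i * fst v ^ i * snd v ^ (N - i))"
    for p :: "real poly" and v :: "real \<times> real"
  have H1: "H p (x, y) = y ^ N * poly p (x / y)" if "degree p \<le> N" "y \<noteq> 0" for p x y
  proof -
    have "poly p (x / y) = (\<Sum>i\<le>N. coeff p i * (x / y) ^ i)"
      unfolding poly_altdef using that(1)
      by (intro sum.mono_neutral_left) (auto intro!: le_degree)
    then show ?thesis using that(2)
      by (simp add: H_def sum_distrib_left power_diff power_divide mult_ac)
  qed
  have H0: "H p (x, 0) = coeff p N * x ^ N" for p x
  proof -
    have "H p (x, 0) = (\<Sum>i\<in>{N}. coeff p i * x ^ i * 0 ^ (N - i))"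
      unfolding H_def fst_conv snd_conv by (intro sum.mono_neutral_right) auto
    then show ?thesis by simp
  qed
  define K where "K = sphere (0 :: real \<times> real) 1"
  have Kx: "x \<noteq> 0" if "(x, 0) \<in> K" for x
    using that by (auto simp: K_def)
  have "\<exists>e0>0. \<forall>e. 0 < e \<and> e < e0 \<longrightarrow> (\<forall>v\<in>K. H P v + e * H D v > 0)"
  proof (rule compact_perturbation_pos)
    show "compact K" by (simp add: K_def)
    show "continuous_on K (H P)" "continuous_on K (H D)"
      unfolding H_def by (intro continuous_intros)+
    fix v assume v: "v \<in> K"
    obtain x y where xy: "v = (x, y)" by (cases v)
    \<comment> \<open>Evenness of \<open>N\<close> makes the homogenising factor positive on both
      halves of the circle, so \<open>H\<close> has the sign of the polynomial, or of its
      \<open>N\<close>-th coefficient where \<open>y = 0\<close>.\<close>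
    have yN: "y \<noteq> 0 \<Longrightarrow> y ^ N > 0" and xN: "x \<noteq> 0 \<Longrightarrow> x ^ N > 0"
      using \<open>even N\<close> by (simp_all add: zero_less_power_eq)
    show "H P v \<ge> 0"
      using yN xN P H1[of P y x] H0[of P x] deg v Kx by (cases "y = 0") (auto simp: xy)
    show "H D v > 0" if "H P v = 0"
      using that yN xN D H1[of P y x] H0[of P x] H1[of D y x] H0[of D x] deg v Kx
      by (cases "y = 0") (auto simp: xy)
  qed
  then obtain e0 where e0: "e0 > 0"
    "\<And>e v. 0 < e \<Longrightarrow> e < e0 \<Longrightarrow> v \<in> K \<Longrightarrow> H P v + e * H D v > 0" by blast
  have "coeff P N + e * coeff D N > 0" if "0 < e" "e < e0" for e
    using e0(2)[OF that, of "(1, 0)"] by (simp add: K_def H0)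
  moreover have "poly P x + e * poly D x > 0" if e: "0 < e" "e < e0" for e x
  proof -
    define r where "r = sqrt (x\<^sup>2 + 1)"
    have r: "r > 0" by (simp add: r_def add_nonneg_pos)
    have "norm (x / r, 1 / r) = 1"
    proof -
      have "norm (x / r, 1 / r) = sqrt ((x\<^sup>2 + 1) / r\<^sup>2)"
        by (simp add: norm_Pair power_divide add_divide_distrib)
      also have "x\<^sup>2 + 1 = r\<^sup>2" by (simp add: r_def)
      also have "r\<^sup>2 / r\<^sup>2 = 1" using r by simp
      finally show ?thesis by simp
    qed
    then have "H P (x / r, 1 / r) + e * H D (x / r, 1 / r) > 0"
      using e0(2)[OF e, of "(x / r, 1 / r)"] by (simp add: K_def)
    then have "(1 / r) ^ N * (poly P x + e * poly D x) > 0"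
      using H1[OF deg(1), of "1 / r" "x / r"] H1[OF deg(2), of "1 / r" "x / r"] r
      by (simp add: algebra_simps)
    then show ?thesis using r by (simp add: zero_less_mult_iff zero_less_power_eq)
  qed
  ultimately show ?thesis using e0(1) by blast
qed

text \<open>Bolzano-Weierstrass for coefficient vectors, passing to a further subsequence for each
  coordinate.\<close>

lemma finite_family_convergent_subsequence:
  fixes f :: "nat \<Rightarrow> nat \<Rightarrow> real"
  assumes "\<And>k i. i < m \<Longrightarrow> \<bar>f k i\<bar> \<le> B"
  shows "\<exists>r l. strict_mono r \<and> (\<forall>i<m. (\<lambda>k. f (r k) i) \<longlonglongrightarrow> l i)"
  using assms
proof (induction m)
  case 0
  show ?case by (intro exI[of _ id]) (simp add: strict_mono_def)
next
  case (Suc m)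
  then obtain r l where r: "strict_mono r" "\<And>i. i < m \<Longrightarrow> (\<lambda>k. f (r k) i) \<longlonglongrightarrow> l i" by force
  have "\<forall>k. f (r k) m \<in> {-B..B}" using Suc.prems[of m] by (auto simp: abs_le_iff minus_le_iff)
  then obtain l' r' where r': "strict_mono r'" "((\<lambda>k. f (r k) m) \<circ> r') \<longlonglongrightarrow> l'"
    using compact_Icc[of "-B" B] unfolding compact_eq_seq_compact_metric seq_compact_def by metis
  have "(\<lambda>k. f ((r \<circ> r') k) i) \<longlonglongrightarrow> (l(m := l')) i" if "i < Suc m" for i
  proof (cases "i = m")
    case True
    then show ?thesis using r'(2) by (simp add: o_def)
  next
    case False
    then show ?thesis using LIMSEQ_subseq_LIMSEQ[OF r(2) r'(1), of i] that by (simp add: o_def)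
  qed
  then show ?case using strict_mono_o[OF r(1) r'(1)] by blast
qed

section \<open>Zeros and touching frequencies\<close>

text \<open>The bisector of the angle between \<open>A\<close> and \<open>B\<close>: with
  \<open>q\<close> the principal square root of \<open>B / A\<close>, both products for
  \<open>A * q\<close> are positive multiples of \<open>q\<close> or its conjugate, and
  \<open>Re q > 0\<close> because \<open>B / A\<close> avoids the nonpositive axis.\<close>

lemma same_side_vector_exists:
  fixes A B :: complex
  assumes "A \<noteq> 0" "B / A \<notin> \<real>\<^sub>\<le>\<^sub>0"
  shows "\<exists>v. Re (v * cnj A) > 0 \<and> Re (v * cnj B) > 0"
proof -
  define q where "q = csqrt (B / A)"
  have q2: "q * q = B / A" by (simp add: q_def flip: power2_eq_square)
  have Rq: "Re q > 0"
  proof (rule ccontr)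
    assume "\<not> Re q > 0"
    then have "Re q = 0" using csqrt_principal[of "B / A"] by (auto simp: q_def)
    then have "q * q = of_real (- (Im q)\<^sup>2)"
      by (simp add: complex_eq_iff power2_eq_square)
    moreover have "complex_of_real (- (Im q)\<^sup>2) \<in> \<real>\<^sub>\<le>\<^sub>0" by (subst nonpos_Reals_of_real_iff) simp
    ultimately have "B / A \<in> \<real>\<^sub>\<le>\<^sub>0" by (simp only: q2)
    then show False using assms by simp
  qed
  have B: "B = A * (q * q)" using q2 assms(1) by (simp add: field_simps)
  have "A * q * cnj A = of_real ((norm A)\<^sup>2) * q"
    by (simp add: complex_norm_square mult_ac del: of_real_power)
  then have "Re (A * q * cnj A) = (norm A)\<^sup>2 * Re q" by (simp only: Re_of_real_mult)
  moreover have "A * q * cnj B = of_real ((norm A)\<^sup>2 * (norm q)\<^sup>2) * cnj q"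
    unfolding B by (simp add: complex_norm_square mult_ac del: of_real_power)
  then have "Re (A * q * cnj B) = (norm A)\<^sup>2 * (norm q)\<^sup>2 * Re q"
    by (simp only: Re_of_real_mult cnj.sel)
  moreover have "norm q > 0" using Rq by auto
  ultimately show ?thesis using Rq assms(1) by (intro exI[of _ "A * q"]) auto
qed

lemma finite_axis_zeros:
  assumes "c \<noteq> 0"
  shows "finite {w. ceval c (\<i> * of_real w) = 0}"
proof -
  have "map_poly complex_of_real c \<noteq> 0" using assms by (simp add: map_poly_eq_0_iff)
  then have "finite {z. ceval c z = 0}" unfolding ceval_def by (rule poly_roots_finite)
  then have "finite ((\<lambda>w. \<i> * complex_of_real w) -` {z. ceval c z = 0})"
    by (rule finite_vimageI) (auto simp: inj_def)
  then show ?thesis by (simp add: vimage_def)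
qed

lemma map_poly_of_real_mult:
  "map_poly complex_of_real (p * q) = map_poly of_real p * map_poly of_real q"
  unfolding poly_eq_poly_eq_iff[symmetric]
  using ceval_mult[of p q] by (auto simp: ceval_def fun_eq_iff)

text \<open>The top coefficient vanishes, so both \<open>c\<close> and \<open>-c\<close> satisfy the
  weak conditions. Hence \<open>c/a\<close> has real part 0 in the right half-plane, and on the
  positive reals it is real, so it is 0.\<close>

lemma axis_re_eq_0_imp_poly_eq_0:
  assumes a: "hurwitz_stable a" "degree a = n" "lead_coeff a = 1"
    and c: "degree c \<le> n" "\<And>w. axis_re c a w = 0"
  shows "c = 0"
proof (rule eq_0_if_ceval_pos_reals_0)
  have "axis_poly c a = 0"
    using poly_all_0_iff_0[of "axis_poly c a"] c(2) by (simp add: poly_axis_poly)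
  then have cn: "coeff c n = 0" using coeff_axis_poly_top[of c n a] a c by simp
  fix x :: real assume x: "x > 0"
  have "poly a x \<noteq> 0" using a(1) x by (auto simp: hurwitz_stable_ceval ceval_of_real dest!: spec[of _ "of_real x"])
  have "Re (ceval c (of_real x) / ceval a (of_real x)) \<ge> 0"
    using a c cn x by (intro nonneg_real_part_right_half_plane) auto
  moreover have "Re (ceval (- c) (of_real x) / ceval a (of_real x)) \<ge> 0"
    using a c cn x axis_re_smult_left[of "-1" c a]
    by (intro nonneg_real_part_right_half_plane) auto
  ultimately show "ceval c (of_real x) = 0"
    using \<open>poly a x \<noteq> 0\<close> by (simp add: ceval_of_real flip: of_real_divide)
qed

text \<open>Negative frequencies are covered by conjugation; a zero at the origin is counted
  separately.\<close>

definition axis_zeros :: "real poly \<Rightarrow> real set" where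
  "axis_zeros c = {w. w > 0 \<and> ceval c (\<i> * of_real w) = 0}"

text \<open>For Hurwitz stable \<open>a\<close> these are the frequencies where \<open>c/a\<close>
  is purely imaginary and nonzero.\<close>

definition axis_touches :: "real poly \<Rightarrow> real poly \<Rightarrow> real set" where
  "axis_touches c a = {w. w > 0 \<and> axis_re c a w = 0 \<and> ceval c (\<i> * of_real w) \<noteq> 0}"

text \<open>Every zero of the nonnegative polynomial \<open>axis_poly c a\<close> is double, and there are two
  of them for every touching frequency.\<close>
lemma card_axis_touches:
  assumes a: "hurwitz_stable a" "degree a = n" "lead_coeff a = 1"
    and c: "degree c \<le> n" "c \<noteq> 0" "\<And>w. axis_re c a w \<ge> 0" and dc: "degree a \<le> degree c + 1"
  shows "finite (axis_touches c a)"
    and "2 * card (axis_touches c a) + 2 * card (axis_zeros c) + (if ceval c 0 = 0 then 1 else 0)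
           \<le> degree c"
proof -
  define P where "P = axis_poly c a"
  have P: "poly P w = axis_re c a w" for w by (simp add: P_def poly_axis_poly)
  have "P \<noteq> 0"
  proof
    assume "P = 0"
    then have "axis_re c a w = 0" for w using P[of w] by simp
    then show False using axis_re_eq_0_imp_poly_eq_0[OF a c(1)] c(2) by blast
  qed
  define Z where "Z = {w. poly P w = 0}"
  have finZ: "finite Z" unfolding Z_def by (rule poly_roots_finite[OF \<open>P \<noteq> 0\<close>])
  have "2 * card Z \<le> degree P" unfolding Z_def
    using \<open>P \<noteq> 0\<close> c(3) by (intro nonneg_poly_card_roots) (auto simp: P)
  \<comment> \<open>The bound \<open>2 * degree c\<close>, rather than \<open>2 * n\<close>, matters
    when \<open>degree c\<close> is \<open>n - 1\<close>.\<close>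
  also have "\<dots> \<le> 2 * degree c" unfolding P_def by (rule degree_axis_poly_le[OF dc])
  finally have cardZ: "card Z \<le> degree c" by simp
  define T where "T = axis_touches c a"
  define A where "A = axis_zeros c"
  \<comment> \<open>The origin is its own mirror image, so it contributes one root, unlike the pairs
    from \<open>T\<close> and \<open>A\<close>.\<close>
  define E where "E = (if ceval c 0 = 0 then {0} else {} :: real set)"
  have sub: "T \<subseteq> Z" "A \<subseteq> Z" "E \<subseteq> Z"
    by (auto simp: T_def A_def E_def Z_def P axis_touches_def axis_zeros_def axis_re_def)
  have pos: "w > 0" if "w \<in> T \<union> A" for w
    using that by (auto simp: T_def A_def axis_touches_def axis_zeros_def)
  have sub': "uminus ` (T \<union> A) \<subseteq> Z"
    using sub by (auto simp: Z_def P axis_re_minus_arg)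
  have fin: "finite T" "finite A" "finite E" using sub finZ by (auto intro: finite_subset)
  then show "finite (axis_touches c a)" by (simp add: T_def)
  have disj: "T \<inter> A = {}" by (auto simp: T_def A_def axis_touches_def axis_zeros_def)
  have "card ((T \<union> A) \<union> uminus ` (T \<union> A) \<union> E) = card (T \<union> A) + card (uminus ` (T \<union> A)) + card E"
  proof (subst card_Un_disjoint)
    show "((T \<union> A) \<union> uminus ` (T \<union> A)) \<inter> E = {}"
      using pos by (fastforce simp: E_def split: if_splits)
    have "(T \<union> A) \<inter> uminus ` (T \<union> A) = {}"
    proof (rule equals0I)
      fix w assume "w \<in> (T \<union> A) \<inter> uminus ` (T \<union> A)"
      then have "w > 0" "- w > 0" using pos[of w] pos[of "- w"] by auto
      then show False by simp
    qed
    then show "card ((T \<union> A) \<union> uminus ` (T \<union> A)) + card E =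
        card (T \<union> A) + card (uminus ` (T \<union> A)) + card E"
      using fin by (subst card_Un_disjoint) auto
  qed (use fin in auto)
  also have "card (uminus ` (T \<union> A)) = card (T \<union> A)" by (intro card_image) (auto simp: inj_on_def)
  also have "card (T \<union> A) = card T + card A" using fin(1,2) disj by (rule card_Un_disjoint)
  finally have "2 * card T + 2 * card A + card E = card ((T \<union> A) \<union> uminus ` (T \<union> A) \<union> E)" by simp
  also have "\<dots> \<le> card Z" using sub sub' finZ by (intro card_mono) auto
  finally have "2 * card T + 2 * card A + card E \<le> degree c" using cardZ by simp
  then show "2 * card (axis_touches c a) + 2 * card (axis_zeros c) + (if ceval c 0 = 0 then 1 else 0)
           \<le> degree c"
    by (simp add: T_def A_def E_def split: if_splits)
qed

text \<open>A zero of \<open>h\<close> outside the left half-plane would be a simple zero of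
  \<open>c\<close> on the axis. But \<open>g\<close> vanishes at each of those already, so the order
  in \<open>c\<close> would be at least 2.\<close>

lemma hurwitz_axis_factorization:
  assumes a: "hurwitz_stable a" and c: "c \<noteq> 0"
    and pr: "\<And>s. Re s \<ge> 0 \<Longrightarrow> Re (ceval c s / ceval a s) \<ge> 0"
  shows "\<exists>g h. c = g * h \<and> hurwitz_stable h \<and> lead_coeff g = 1 \<and>
    degree g = 2 * card (axis_zeros c) + (if ceval c 0 = 0 then 1 else 0) \<and>
    (\<forall>w\<in>axis_zeros c. ceval g (\<i> * of_real w) = 0) \<and>
    (ceval c 0 = 0 \<longrightarrow> ceval g 0 = 0)"
proof -
  define A where "A = axis_zeros c"
  have A: "w > 0" "ceval c (\<i> * of_real w) = 0" if "w \<in> A" for w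
    using that by (auto simp: A_def axis_zeros_def)
  have finA: "finite A" unfolding A_def axis_zeros_def
    by (rule finite_subset[OF _ finite_axis_zeros[OF c]]) auto
  define gA where "gA = (\<Prod>w\<in>A. [:w\<^sup>2, 0, 1:])"
  define g where "g = gA * (if ceval c 0 = 0 then [:0, 1:] else 1)"
  obtain q where q: "c = gA * q"
    using axis_zeros_prod_dvd[of A c] finA A unfolding gA_def by (auto elim: dvdE)
  have gA0: "ceval gA 0 \<noteq> 0" using finA A(1) by (force simp: gA_def)
  have "g dvd c"
  proof (cases "ceval c 0 = 0")
    case True
    then have "ceval q (of_real 0) = 0" using gA0 by (simp add: q)
    then have "poly q 0 = 0" by (simp only: ceval_of_real of_real_eq_0_iff)
    then have "[:0, 1:] dvd q" using poly_eq_0_iff_dvd[of q 0] by simp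
    then have "gA * [:0, 1:] dvd gA * q" by (intro mult_dvd_mono dvd_refl)
    moreover have "g = gA * [:0, 1:]" using True by (simp add: g_def)
    ultimately show ?thesis by (simp only: q)
  qed (simp add: g_def q)
  then obtain h where h: "c = g * h" by (elim dvdE)
  have gw: "ceval g (\<i> * of_real w) = 0" if "w \<in> A" for w
  proof -
    have "ceval [:w\<^sup>2, 0, 1:] (\<i> * of_real w) = 0" by (simp add: power2_eq_square algebra_simps)
    then have "ceval gA (\<i> * of_real w) = 0"
      unfolding gA_def ceval_prod using that finA by (intro prod_zero) auto
    then show ?thesis by (simp add: g_def)
  qed
  have g0: "ceval g 0 = 0" if "ceval c 0 = 0" using that by (simp add: g_def)
  have "hurwitz_stable h" unfolding hurwitz_stable_ceval
  proof (intro allI impI, rule ccontr)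
    fix z assume z: "ceval h z = 0" "\<not> Re z < 0"
    then have cz: "ceval c z = 0" by (simp add: h)
    have ord: "Re z = 0" "order z (map_poly complex_of_real c) = 1"
      using positive_real_zero_order[OF a c pr, of z] z(2) cz by auto
    have zi: "z = \<i> * of_real (Im z)" using ord(1) by (simp add: complex_eq_iff)
    have gz: "ceval g z = 0"
    proof (cases "Im z" "0 :: real" rule: linorder_cases)
      case greater
      then have "Im z \<in> A" using cz zi by (simp add: A_def axis_zeros_def)
      then show ?thesis using gw zi by metis
    next
      case equal
      then show ?thesis using g0 cz zi by simp
    next
      case less
      have "cnj z = \<i> * of_real (- Im z)" by (subst zi) simp
      moreover from this have "- Im z \<in> A"
        using cz less ceval_cnj[of c z] by (simp add: A_def axis_zeros_def)
      ultimately have "ceval g (cnj z) = 0" using gw by metis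
      then show ?thesis by (simp add: ceval_cnj)
    qed
    define G where "G = map_poly complex_of_real g"
    define H where "H = map_poly complex_of_real h"
    have GH: "map_poly complex_of_real c = G * H" by (simp add: h G_def H_def map_poly_of_real_mult)
    have "G * H \<noteq> 0" using c GH by (metis map_poly_eq_0_iff of_real_0 of_real_eq_0_iff)
    then have "order z (G * H) = order z G + order z H" by (rule order_mult)
    moreover have "order z G \<noteq> 0" "order z H \<noteq> 0"
      using \<open>G * H \<noteq> 0\<close> z(1) gz by (auto simp: order_root[symmetric] ceval_def G_def H_def order_eq_0_iff)
    ultimately show False using ord(2) GH by simp
  qed
  moreover have lcA: "lead_coeff gA = 1" "degree gA = 2 * card A"
  proof -
    show "lead_coeff gA = 1" unfolding gA_def lead_coeff_prod by simp
    show "degree gA = 2 * card A" unfolding gA_def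
      by (subst degree_prod_eq_sum_degree) auto
  qed
  moreover have "lead_coeff g = 1" unfolding g_def lead_coeff_mult using lcA by simp
  moreover have "degree g = 2 * card A + (if ceval c 0 = 0 then 1 else 0)"
  proof -
    have "gA \<noteq> 0" using lcA by auto
    then show ?thesis unfolding g_def by (subst degree_mult_eq) (auto simp: lcA(2))
  qed
  ultimately show ?thesis using h gw g0 unfolding A_def by blast
qed

section \<open>From weak to strict positivity\<close>

text \<open>The even and odd parts of \<open>p\<close> are interpolated separately.\<close>
lemma axis_interpolation_exists:
  assumes A: "finite A" "\<And>w. w \<in> A \<Longrightarrow> w > 0"
  shows "\<exists>p. degree p \<le> 2 * card A \<and> ceval p 0 = of_real x0 \<and>
    (\<forall>w\<in>A. ceval p (\<i> * of_real w) = v w)"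
proof -
  define A' where "A' = (\<lambda>w. - w\<^sup>2) ` A"
  have sq: "sqrt (- (- w\<^sup>2)) = w" if "w \<in> A" for w using A(2)[OF that] by simp
  have "inj_on (\<lambda>w. - w\<^sup>2) A"
    by (rule inj_on_inverseI[where g = "\<lambda>x. sqrt (- x)"]) (rule sq)
  then have cA': "card A' = card A" unfolding A'_def by (rule card_image)
  have finA': "finite A'" using A(1) by (simp add: A'_def)
  have 0: "0 \<notin> A'" using A(2)[of 0] by (auto simp: A'_def)
  \<comment> \<open>In \<open>p(s) = E(s\<^sup>2) + s Od(s\<^sup>2)\<close> the even part also takes
    the node 0, which fixes the value at the origin; its degree still stays within
    \<open>2 * card A\<close>.\<close>
  obtain E where E: "E = 0 \<or> degree E < card (insert 0 A')"
    "\<forall>x\<in>insert 0 A'. poly E x = (if x = 0 then x0 else Re (v (sqrt (- x))))"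
    using poly_interpolation_exists[of "insert 0 A'" "\<lambda>x. if x = 0 then x0 else Re (v (sqrt (- x)))"]
      finA' by blast
  obtain Od where Od: "Od = 0 \<or> degree Od < card A'"
    "\<forall>x\<in>A'. poly Od x = Im (v (sqrt (- x))) / sqrt (- x)"
    using poly_interpolation_exists[of A' "\<lambda>x. Im (v (sqrt (- x))) / sqrt (- x)"] finA' by blast
  define p where "p = pcompose E [:0, 0, 1:] + [:0, 1:] * pcompose Od [:0, 0, 1:]"
  have degE: "degree (pcompose E [:0, 0, 1:]) \<le> 2 * card A"
    using degree_pcompose_le[of E "[:0, 0, 1:]"] E(1) 0 finA' cA' by auto
  have degO: "degree ([:0, 1:] * pcompose Od [:0, 0, 1:]) \<le> 2 * card A"
  proof (cases "Od = 0")
    case False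
    then have "degree Od < card A" using Od(1) cA' by simp
    moreover have "degree ([:0, 1:] * pcompose Od [:0, 0, 1:]) \<le> 1 + degree Od * 2"
      using degree_mult_le[of "[:0, 1:]" "pcompose Od [:0, 0, 1:]"]
        degree_pcompose_le[of Od "[:0, 0, 1:]"] by simp
    ultimately show ?thesis by linarith
  qed simp
  have "degree p \<le> 2 * card A" unfolding p_def by (rule degree_add_le[OF degE degO])
  moreover have "ceval p 0 = of_real x0"
    using E(2) ceval_of_real[of E 0] by (simp add: p_def)
  moreover have "ceval p (\<i> * of_real w) = v w" if w: "w \<in> A" for w
  proof -
    have wA': "- w\<^sup>2 \<in> A'" using w by (simp add: A'_def)
    have w0: "w > 0" by (rule A(2)[OF w])
    have e: "poly E (- w\<^sup>2) = Re (v w)" using E(2) wA' sq[OF w] w0 by auto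
    have o: "poly Od (- w\<^sup>2) = Im (v w) / w" using Od(2) wA' sq[OF w] by auto
    have "ceval [:0, 0, 1:] (\<i> * of_real w) = of_real (- w\<^sup>2)"
      by (simp add: power2_eq_square algebra_simps)
    then have "ceval p (\<i> * of_real w) =
        of_real (poly E (- w\<^sup>2)) + \<i> * of_real w * of_real (poly Od (- w\<^sup>2))"
      by (simp only: p_def ceval_add ceval_mult ceval_pcompose ceval_of_real) simp
    also have "\<dots> = v w" unfolding e o using w0 by (simp add: complex_eq_iff)
    finally show ?thesis .
  qed
  ultimately show ?thesis by blast
qed

text \<open>After multiplication by \<open>|h|\<^sup>2\<close> the term \<open>g d1\<close> times
  the conjugate of \<open>x\<close> becomes \<open>d1 conj h\<close> times \<open>c conj x\<close>.
  The latter is purely imaginary here, so only \<open>Im (d1 conj h)\<close> enters the real part,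
  and \<open>d\<close> solves for the value 1.\<close>

lemma axis_re_correction:
  assumes c: "c = g * h" and h: "ceval h z \<noteq> 0" and z: "z = \<i> * of_real w"
    and t: "axis_re c x w = 0" and cx: "ceval c z * cnj (ceval x z) \<noteq> 0"
    and d: "Im (ceval d1 z * cnj (ceval h z)) =
              (norm (ceval h z))\<^sup>2 * (axis_re d0 x w - 1) / Im (ceval c z * cnj (ceval x z))"
  shows "axis_re (d0 + g * d1) x w = 1"
proof -
  define y where "y = Im (ceval c z * cnj (ceval x z))"
  have cxy: "ceval c z * cnj (ceval x z) = \<i> * of_real y"
    using t by (simp add: complex_eq_iff y_def axis_re_def z)
  have "y \<noteq> 0" using cx cxy by auto
  have hn: "(norm (ceval h z))\<^sup>2 \<noteq> 0" using h by simp
  have "of_real ((norm (ceval h z))\<^sup>2) * (ceval (g * d1) z * cnj (ceval x z)) =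
      (ceval d1 z * cnj (ceval h z)) * (ceval c z * cnj (ceval x z))"
    by (simp add: c complex_norm_square mult_ac del: of_real_power)
  also have "\<dots> = (ceval d1 z * cnj (ceval h z)) * (\<i> * of_real y)" by (simp only: cxy)
  finally have "Re (of_real ((norm (ceval h z))\<^sup>2) * (ceval (g * d1) z * cnj (ceval x z))) =
      Re ((ceval d1 z * cnj (ceval h z)) * (\<i> * of_real y))" by (rule arg_cong)
  also have "\<dots> = - (y * Im (ceval d1 z * cnj (ceval h z)))" by (simp add: algebra_simps)
  finally have "Re (of_real ((norm (ceval h z))\<^sup>2) * (ceval (g * d1) z * cnj (ceval x z))) =
      - (y * Im (ceval d1 z * cnj (ceval h z)))" .
  moreover have "Re (of_real ((norm (ceval h z))\<^sup>2) * (ceval (g * d1) z * cnj (ceval x z))) =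
      (norm (ceval h z))\<^sup>2 * axis_re (g * d1) x w"
    unfolding axis_re_def z[symmetric]
    by (simp only: Re_of_real_mult)
  ultimately have "(norm (ceval h z))\<^sup>2 * axis_re (g * d1) x w =
      (norm (ceval h z))\<^sup>2 * (1 - axis_re d0 x w)"
    unfolding d y_def[symmetric] using \<open>y \<noteq> 0\<close> by (simp add: field_simps)
  then have "axis_re (g * d1) x w = 1 - axis_re d0 x w" using hn by simp
  then show ?thesis by (simp add: axis_re_add_left)
qed

text \<open>Since \<open>x\<close> is monic, the coefficients of the axis polynomials at
  \<open>2 * n\<close> are those of \<open>c\<close> and \<open>d\<close> at \<open>n\<close>; this
  controls infinite frequency together with the finite ones.\<close>

lemma axis_re_perturbation_pos:
  assumes x: "degree x = n" "lead_coeff x = 1"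
    and c: "degree c \<le> n" "coeff c n \<ge> 0" "\<And>w. axis_re c x w \<ge> 0"
    and d: "degree d \<le> n" "coeff c n = 0 \<Longrightarrow> coeff d n > 0"
      "\<And>w. axis_re c x w = 0 \<Longrightarrow> axis_re d x w > 0"
  shows "\<exists>e0>0. \<forall>e. 0 < e \<and> e < e0 \<longrightarrow>
    coeff (c + smult e d) n > 0 \<and> (\<forall>w. axis_re (c + smult e d) x w > 0)"
proof -
  have top: "coeff (axis_poly c x) (2 * n) = coeff c n" "coeff (axis_poly d x) (2 * n) = coeff d n"
    using coeff_axis_poly_top[of _ n x] x c(1) d(1) by auto
  have "\<exists>e0>0. \<forall>e. 0 < e \<and> e < e0 \<longrightarrow>
    coeff (axis_poly c x) (2 * n) + e * coeff (axis_poly d x) (2 * n) > 0 \<and>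
    (\<forall>w. poly (axis_poly c x) w + e * poly (axis_poly d x) w > 0)"
    using c d x by (intro poly_perturbation_pos degree_axis_poly_le') (auto simp: top poly_axis_poly)
  then show ?thesis
    by (simp add: top poly_axis_poly axis_re_add_left axis_re_smult_left)
qed

text \<open>The two families of touching frequencies together have at most \<open>degree h\<close> elements, which is
  exactly the number of interpolation conditions available in the direction \<open>d\<close>.\<close>
lemma common_spr_weak_imp_strict:
  assumes a: "hurwitz_stable a" "degree a = n" "lead_coeff a = 1"
    and b: "hurwitz_stable b" "degree b = n" "lead_coeff b = 1"
    and seg: "\<And>w. ceval b (\<i> * of_real w) / ceval a (\<i> * of_real w) \<notin> \<real>\<^sub>\<le>\<^sub>0"
    and c: "c \<noteq> 0" "degree c \<le> n" "coeff c n \<ge> 0"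
      "\<And>w. axis_re c a w \<ge> 0" "\<And>w. axis_re c b w \<ge> 0"
  shows "\<exists>c'. degree c' \<le> n \<and> coeff c' n > 0 \<and> (\<forall>w. axis_re c' a w > 0 \<and> axis_re c' b w > 0)"
proof -
  have pr: "Re (ceval c s / ceval a s) \<ge> 0" if "Re s \<ge> 0" for s
    using nonneg_real_part_right_half_plane[OF a c(2,3,4) that] .
  have dc: "n \<le> degree c + 1" using positive_real_degree[OF a(1) c(1) pr] a(2) by simp
  define A where "A = axis_zeros c"
  have A: "finite A" "\<And>w. w \<in> A \<Longrightarrow> w > 0"
    unfolding A_def axis_zeros_def
    by (rule finite_subset[OF _ finite_axis_zeros[OF c(1)]]) auto
  obtain g h where gh: "c = g * h" "hurwitz_stable h" "lead_coeff g = 1"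
    "degree g = 2 * card A + (if ceval c 0 = 0 then 1 else 0)"
    "\<And>w. w \<in> A \<Longrightarrow> ceval g (\<i> * of_real w) = 0"
    "ceval c 0 = 0 \<Longrightarrow> ceval g 0 = 0"
    using hurwitz_axis_factorization[OF a(1) c(1) pr] unfolding A_def by blast
  have "g \<noteq> 0" "h \<noteq> 0" using gh(1) c(1) by auto
  then have degc: "degree c = degree g + degree h" unfolding gh(1) by (rule degree_mult_eq)
  define T where "T = axis_touches c a \<union> axis_touches c b"
  have T: "finite T" "card T \<le> degree h" "\<And>w. w \<in> T \<Longrightarrow> w > 0"
  proof -
    \<comment> \<open>Removing \<open>degree g\<close> from the root count leaves
      \<open>degree h\<close>, of which each family uses at most half.\<close>
    have ta: "finite (axis_touches c a)" "2 * card (axis_touches c a) \<le> degree h"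
      using card_axis_touches[OF a c(2,1,4)] dc a(2) degc gh(4) by (auto simp: A_def)
    have tb: "finite (axis_touches c b)" "2 * card (axis_touches c b) \<le> degree h"
      using card_axis_touches[OF b c(2,1,5)] dc b(2) degc gh(4) by (auto simp: A_def)
    show "finite T" using ta tb by (simp add: T_def)
    show "card T \<le> degree h"
      unfolding T_def by (rule order.trans[OF card_Un_le]) (use ta tb in linarith)
    show "\<And>w. w \<in> T \<Longrightarrow> w > 0" by (auto simp: T_def axis_touches_def)
  qed
  have axis_nz: "ceval p (\<i> * of_real w) \<noteq> 0" if "hurwitz_stable p" for p w
    using that by (auto simp: hurwitz_stable_ceval dest!: spec[of _ "\<i> * of_real w"])

  have "\<exists>v. Re (v * cnj (ceval a (\<i> * of_real w))) > 0 \<and> Re (v * cnj (ceval b (\<i> * of_real w))) > 0"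
    for w by (rule same_side_vector_exists[OF axis_nz[OF a(1)] seg])
  then obtain v where v: "\<And>w. Re (v w * cnj (ceval a (\<i> * of_real w))) > 0"
    "\<And>w. Re (v w * cnj (ceval b (\<i> * of_real w))) > 0" by metis
  obtain p where p: "degree p \<le> 2 * card A" "ceval p 0 = of_real (poly a 0)"
    "\<And>w. w \<in> A \<Longrightarrow> ceval p (\<i> * of_real w) = v w"
    using axis_interpolation_exists[OF A, of "poly a 0" v] by blast
  \<comment> \<open>The first summand sets the values at the axis zeros of \<open>c\<close>. The
    second vanishes there with \<open>g\<close> and supplies the leading coefficient 1 in degree
    \<open>n\<close> when \<open>coeff c n = 0\<close>.\<close>
  define d0 where "d0 = p + g * monom 1 (n - degree g)"
  \<comment> \<open>Only one condition per frequency can be imposed; where both quotients touch, it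
    is imposed for \<open>a\<close>.\<close>
  define tgt where "tgt w = (let x = (if w \<in> axis_touches c a then a else b); z = \<i> * of_real w in
    (norm (ceval h z))\<^sup>2 * (axis_re d0 x w - 1) / Im (ceval c z * cnj (ceval x z)))" for w
  obtain d1 where d1: "degree d1 \<le> degree h"
    "\<And>w. w \<in> T \<Longrightarrow> Im (ceval d1 (\<i> * of_real w) * cnj (ceval h (\<i> * of_real w))) = tgt w"
    using hurwitz_axis_im_interpolation[OF gh(2) T(1,3,2), of tgt] by blast
  define d where "d = d0 + g * d1"
  have degg: "degree g \<le> n" using degc c(2) by linarith
  have degp: "degree p \<le> degree g" using p(1) gh(4) by linarith
  have dgm: "degree (g * monom 1 (n - degree g)) \<le> n"
    by (rule order.trans[OF degree_mult_le]) (use degg in \<open>simp add: degree_monom_eq\<close>)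
  have dgd: "degree (g * d1) \<le> degree c"
    by (rule order.trans[OF degree_mult_le]) (use degc d1(1) in linarith)
  have degd: "degree d \<le> n" unfolding d_def d0_def
    using degp degg dgm dgd c(2) by (intro degree_add_le) auto
  have topd: "coeff d n > 0" if "coeff c n = 0"
  proof -
    have "degree c < n" using that c(1,2) by (metis leading_coeff_0_iff le_neq_implies_less)
    moreover have "coeff (g * monom 1 (n - degree g)) (degree g + (n - degree g)) =
        coeff g (degree g) * coeff (monom 1 (n - degree g)) (n - degree g)"
      by (rule coeff_mult_top) (simp_all add: degree_monom_eq)
    ultimately show ?thesis
      using degg dgd degp degc gh(3) by (simp add: d_def d0_def coeff_eq_0)
  qed

  have zeros: "axis_re d x w > 0"
    if x: "x = a \<or> x = b" and w: "axis_re c x w = 0" for x w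
  proof -
    have x_stable: "hurwitz_stable x" using x a b by auto
    have pos: "axis_re d x w > 0" if w: "axis_re c x w = 0" and "w > 0" for w
    proof -
      define z where "z = \<i> * complex_of_real w"
      show ?thesis
      proof (cases "ceval c z = 0")
        case True
        then have wA: "w \<in> A" using \<open>w > 0\<close> by (simp add: A_def axis_zeros_def z_def)
        have "ceval d z = v w" using p(3)[OF wA] gh(5)[OF wA] by (simp add: d_def d0_def z_def)
        then show ?thesis using v x by (auto simp: axis_re_def z_def)
      next
        case False
        have touch: "axis_re d y w = 1"
          if "w \<in> T" "y = (if w \<in> axis_touches c a then a else b)" for y
        proof -
          have y: "axis_re c y w = 0" "hurwitz_stable y"
            using that a b by (auto simp: T_def axis_touches_def)
          have cy: "ceval c z * cnj (ceval y z) \<noteq> 0"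
            using False axis_nz[OF y(2), of w] by (simp add: z_def)
          show ?thesis unfolding d_def
            by (rule axis_re_correction[OF gh(1) _ z_def y(1) cy])
               (use d1(2)[OF that(1)] that(2) axis_nz[OF gh(2), of w]
                in \<open>auto simp: tgt_def Let_def z_def\<close>)
        qed
        have wx: "w \<in> axis_touches c x"
          using w \<open>w > 0\<close> False by (simp add: axis_touches_def z_def)
        then have wT: "w \<in> T" using x by (auto simp: T_def)
        show ?thesis
        proof (cases "x = b \<and> w \<in> axis_touches c a")
          case False
          then show ?thesis using touch[OF wT refl] x wx by (auto split: if_splits)
        next
          case True
          \<comment> \<open>At a common touching frequency both products with \<open>c\<close> are
            purely imaginary, so \<open>b/a\<close> is real there, and positive by
            \<open>seg\<close>. The inequality for \<open>b\<close> is then a positive multiple of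
            that for \<open>a\<close>.\<close>
          have da: "axis_re d a w = 1" using touch[OF wT refl] True by simp
          define \<alpha> where "\<alpha> = ceval a z"
          define \<beta> where "\<beta> = ceval b z"
          have nz: "\<alpha> \<noteq> 0" "\<beta> \<noteq> 0" using axis_nz a b by (auto simp: \<alpha>_def \<beta>_def z_def)
          have ra: "ceval c z * cnj \<alpha> = \<i> * of_real (Im (ceval c z * cnj \<alpha>))"
            using True by (simp add: complex_eq_iff axis_touches_def axis_re_def \<alpha>_def z_def)
          have rb: "ceval c z * cnj \<beta> = \<i> * of_real (Im (ceval c z * cnj \<beta>))"
            using True w by (simp add: complex_eq_iff axis_touches_def axis_re_def \<beta>_def z_def)
          define r where "r = Im (ceval c z * cnj \<beta>) / Im (ceval c z * cnj \<alpha>)"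
          have "cnj \<beta> / cnj \<alpha> = (ceval c z * cnj \<beta>) / (ceval c z * cnj \<alpha>)"
            using \<open>ceval c z \<noteq> 0\<close> by simp
          also have "\<dots> = of_real r" by (subst ra, subst rb) (simp add: r_def)
          finally have "cnj (\<beta> / \<alpha>) = of_real r" by simp
          then have ba: "\<beta> / \<alpha> = of_real r" by (metis complex_cnj_cnj complex_cnj_complex_of_real)
          then have "r > 0" using seg[of w]
            by (metis \<alpha>_def \<beta>_def z_def nonpos_Reals_of_real_iff not_le)
          have "\<beta> = of_real r * \<alpha>" using ba nz by (simp add: field_simps)
          then have "axis_re d b w = r * axis_re d a w"
            unfolding axis_re_def z_def[symmetric] \<alpha>_def[symmetric] \<beta>_def[symmetric]
            by (simp add: algebra_simps)
          then show ?thesis using da \<open>r > 0\<close> True by simp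
        qed
      qed
    qed
    show ?thesis
    proof (cases w "0 :: real" rule: linorder_cases)
      case greater
      then show ?thesis using pos w by blast
    next
      case less
      then show ?thesis using pos[of "- w"] w by (simp add: axis_re_minus_arg)
    next
      case equal
      \<comment> \<open>At frequency 0 all values are real; \<open>seg\<close> gives
        \<open>a\<close> and \<open>b\<close> the same sign, so the value \<open>a(0)\<close> chosen
        for \<open>d\<close> serves both.\<close>
      have x0: "poly x 0 \<noteq> 0" "poly a 0 \<noteq> 0"
        using axis_nz[OF x_stable, of 0] axis_nz[OF a(1), of 0] ceval_of_real[of _ 0] by auto
      have "complex_of_real (poly b 0 / poly a 0) \<notin> \<real>\<^sub>\<le>\<^sub>0"
        using seg[of 0] ceval_of_real[of _ 0] by simp
      then have "poly b 0 / poly a 0 > 0" by (metis nonpos_Reals_of_real_iff not_le)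
      then have ax: "poly a 0 * poly x 0 > 0"
        using x x0 by (auto simp: zero_less_divide_iff zero_less_mult_iff)
      have "ceval c 0 = 0"
        using w equal x0(1) ceval_of_real[of _ 0] by (simp add: axis_re_def)
      then have "ceval d 0 = of_real (poly a 0)" using p(2) gh(6) by (simp add: d_def d0_def)
      then show ?thesis using equal ax ceval_of_real[of x 0] by (simp add: axis_re_def)
    qed
  qed

  obtain ea where ea: "ea > 0" "\<And>e. 0 < e \<Longrightarrow> e < ea \<Longrightarrow>
      coeff (c + smult e d) n > 0 \<and> (\<forall>w. axis_re (c + smult e d) a w > 0)"
    using axis_re_perturbation_pos[OF a(2,3) c(2,3,4) degd topd zeros] by blast
  obtain eb where eb: "eb > 0" "\<And>e. 0 < e \<Longrightarrow> e < eb \<Longrightarrow>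
      coeff (c + smult e d) n > 0 \<and> (\<forall>w. axis_re (c + smult e d) b w > 0)"
    using axis_re_perturbation_pos[OF b(2,3) c(2,3,5) degd topd zeros] by blast
  define e where "e = min ea eb / 2"
  have "0 < e" "e < ea" "e < eb" using ea(1) eb(1) by (auto simp: e_def min_def)
  moreover have "degree (c + smult e d) \<le> n"
    using c(2) degd by (intro degree_add_le order.trans[OF degree_smult_le])
  ultimately show ?thesis using ea(2) eb(2) by blast
qed

section \<open>The segment\<close>

lemma SPR_axis_re:
  "SPR c a \<longleftrightarrow> degree c = degree a \<and> hurwitz_stable a \<and> (\<forall>w. axis_re c a w > 0)"
  by (simp only: SPR_def axis_re_def ceval_def Re_complex_div_gt_0)

text \<open>If the ratio were \<open>r \<le> 0\<close>, subtracting \<open>r a\<close> and rescaling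
  by \<open>1 - r\<close> would give the member of the segment with parameter
  \<open>l / (1 - r)\<close>, vanishing on the axis.\<close>

lemma segment_axis_ratio_not_nonpos:
  assumes st: "\<And>t. 0 \<le> t \<Longrightarrow> t \<le> 1 \<Longrightarrow> hurwitz_stable (smult t b + smult (1 - t) a)"
    and l: "0 \<le> l" "l \<le> 1" and a: "hurwitz_stable a" and z: "Re z = 0"
  shows "ceval (smult l b + smult (1 - l) a) z / ceval a z \<notin> \<real>\<^sub>\<le>\<^sub>0"
proof
  assume "ceval (smult l b + smult (1 - l) a) z / ceval a z \<in> \<real>\<^sub>\<le>\<^sub>0"
  then obtain r where r: "r \<le> 0" "ceval (smult l b + smult (1 - l) a) z / ceval a z = of_real r"
    by (auto elim: nonpos_Reals_cases)
  have az: "ceval a z \<noteq> 0" using a z by (auto simp: hurwitz_stable_ceval)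
  have eq: "of_real l * ceval b z + of_real (1 - l) * ceval a z = of_real r * ceval a z"
    using r(2) unfolding nonzero_divide_eq_eq[OF az] by (simp only: ceval_add ceval_smult)
  define t where "t = l / (1 - r)"
  have t: "0 \<le> t" "t \<le> 1" using l r(1) by (auto simp: t_def field_simps)
  have l_eq: "l = t * (1 - r)" using r(1) by (simp add: t_def)
  have "of_real (1 - r) * ceval (smult t b + smult (1 - t) a) z =
      of_real l * ceval b z + of_real (1 - l) * ceval a z - of_real r * ceval a z"
    by (simp add: l_eq algebra_simps)
  also have "\<dots> = 0" using eq by simp
  finally have "ceval (smult t b + smult (1 - t) a) z = 0"
    using r(1) by (simp only: mult_eq_0_iff of_real_eq_0_iff) auto
  then show False using st[OF t] z unfolding hurwitz_stable_ceval by force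
qed

text \<open>A convex combination of two positive real parts is positive, so no member of the segment
  vanishes on the axis. The homotopy from \<open>a\<close> runs through the members with parameters
  \<open>t * l\<close>, all with \<open>n\<close>-th coefficient 1.\<close>

lemma spr_common_imp_segment_stable:
  assumes a: "degree a = n" "lead_coeff a = 1" "hurwitz_stable a"
    and b: "degree b = n" "lead_coeff b = 1"
    and c: "\<And>w. axis_re c a w > 0" "\<And>w. axis_re c b w > 0"
    and l: "0 \<le> l" "l \<le> 1"
  shows "hurwitz_stable (smult l b + smult (1 - l) a)"
  unfolding hurwitz_stable_ceval
proof (intro allI impI)
  define p where "p = smult l b + smult (1 - l) a"
  fix z assume z: "ceval p z = 0"
  have degp: "degree p \<le> n" unfolding p_def
    using a b by (intro degree_add_le order.trans[OF degree_smult_le]) auto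
  have cp: "coeff p n = 1" using a b by (simp add: p_def)
  show "Re z < 0"
  proof (rule left_half_plane_roots_homotopy[of "map_poly of_real a" n "map_poly of_real p"])
    show "degree (map_poly complex_of_real a) \<le> n" "degree (map_poly complex_of_real p) \<le> n"
      using a degp by (subst degree_map_poly; simp)+
    show "(1 - of_real t) * coeff (map_poly of_real a) n + of_real t * coeff (map_poly of_real p) n
        \<noteq> (0 :: complex)" for t
      using a cp by (simp add: coeff_map_poly)
    show "Re s < 0" if "poly (map_poly of_real a) s = 0" for s
      using a(3) that by (simp add: hurwitz_stable_def)
    show "poly (map_poly of_real p) z = 0" using z by (simp add: ceval_def)
    fix t :: real and s assume t: "0 \<le> t" "t \<le> 1" and s: "Re s = 0"
    have "t * l \<le> 1" using t l by (simp add: mult_le_one)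
    show "(1 - of_real t) * poly (map_poly of_real a) s + of_real t * poly (map_poly of_real p) s \<noteq> 0"
    proof
      assume 0: "(1 - of_real t) * poly (map_poly of_real a) s + of_real t * poly (map_poly of_real p) s = 0"
      have si: "s = \<i> * of_real (Im s)" using s by (simp add: complex_eq_iff)
      have "ceval (smult (t * l) b + smult (1 - t * l) a) s = 0"
        using 0 unfolding ceval_def[symmetric] by (simp add: p_def algebra_simps)
      then have "axis_re c (smult (t * l) b + smult (1 - t * l) a) (Im s) = 0"
        unfolding axis_re_def si[symmetric] by simp
      then have "t * l * axis_re c b (Im s) + (1 - t * l) * axis_re c a (Im s) = 0"
        by (simp only: axis_re_add_right axis_re_smult_right)
      moreover define u where "u = t * l"
      moreover have "u * axis_re c b (Im s) + (1 - u) * axis_re c a (Im s) > 0"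
      proof (cases "u = 0")
        case False
        then have "u > 0" using t l by (simp add: less_le u_def)
        then show ?thesis using c[of "Im s"] \<open>t * l \<le> 1\<close>[folded u_def]
          by (intro add_pos_nonneg mult_pos_pos mult_nonneg_nonneg) (auto simp: less_imp_le)
      qed (use c in auto)
      ultimately show False by simp
    qed
  qed
qed

section \<open>Closedness and openness of the set of solvable parameters\<close>

lemma axis_re_tendsto:
  assumes "\<And>k. degree (f k) \<le> n" "degree c \<le> n"
    and "\<And>i. i \<le> n \<Longrightarrow> (\<lambda>k. coeff (f k) i) \<longlonglongrightarrow> coeff c i"
  shows "(\<lambda>k. axis_re (f k) a w) \<longlonglongrightarrow> axis_re c a w"
proof -
  define z where "z = \<i> * complex_of_real w"
  have "(\<lambda>k. \<Sum>i\<le>n. of_real (coeff (f k) i) * z ^ i) \<longlonglongrightarrow> (\<Sum>i\<le>n. of_real (coeff c i) * z ^ i)"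
    by (intro tendsto_intros assms(3)) auto
  then have "(\<lambda>k. ceval (f k) z) \<longlonglongrightarrow> ceval c z"
    using assms(1,2) by (simp add: ceval_altdef[where n = n])
  then show ?thesis unfolding axis_re_def z_def[symmetric] by (intro tendsto_intros)
qed

lemma weak_limit_exists:
  assumes c: "\<And>k. degree (c k) \<le> n" "\<And>k. coeff (c k) n > 0"
    and pos: "\<And>k w. axis_re (c k) a w > 0" "\<And>k w. axis_re (c k) (p k) w > 0"
    and p: "\<And>k. p k = smult (x k) b + smult (1 - x k) a" and x: "x \<longlonglongrightarrow> l"
  shows "\<exists>c'. c' \<noteq> 0 \<and> degree c' \<le> n \<and> coeff c' n \<ge> 0 \<and> (\<forall>w. axis_re c' a w \<ge> 0) \<and>
    (\<forall>w. axis_re c' (smult l b + smult (1 - l) a) w \<ge> 0)"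
proof -
  \<comment> \<open>Normalising the coefficient sum to 1 gives a bounded family and prevents the
    limit from being zero.\<close>
  define N where "N k = (\<Sum>i\<le>n. \<bar>coeff (c k) i\<bar>)" for k
  have N: "N k > 0" for k unfolding N_def
    by (rule sum_pos2[of _ n]) (use c(2)[of k] in auto)
  define f where "f k = smult (inverse (N k)) (c k)" for k
  have cf: "coeff (f k) i = inverse (N k) * coeff (c k) i" for k i by (simp add: f_def)
  have sum1: "(\<Sum>i\<le>n. \<bar>coeff (f k) i\<bar>) = 1" for k
    using N[of k] by (simp add: cf abs_mult N_def[symmetric] flip: sum_distrib_left)
  have "\<bar>coeff (f k) i\<bar> \<le> 1" if "i < Suc n" for k i
    using member_le_sum[of i "{..n}" "\<lambda>i. \<bar>coeff (f k) i\<bar>"] that sum1[of k] by auto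
  then obtain r L where r: "strict_mono r" "\<And>i. i < Suc n \<Longrightarrow> (\<lambda>k. coeff (f (r k)) i) \<longlonglongrightarrow> L i"
    using finite_family_convergent_subsequence[of "Suc n" "\<lambda>k. coeff (f k)" 1] by blast
  define c' where "c' = (\<Sum>i\<le>n. monom (L i) i)"
  have cc': "coeff c' i = (if i \<le> n then L i else 0)" for i
    by (auto simp: c'_def coeff_sum)
  have lim: "(\<lambda>k. coeff (f (r k)) i) \<longlonglongrightarrow> coeff c' i" if "i \<le> n" for i
    using r(2)[of i] that by (simp add: cc')
  have degc': "degree c' \<le> n" by (rule degree_le) (simp add: cc')
  have degf: "degree (f k) \<le> n" for k
    unfolding f_def by (rule order.trans[OF degree_smult_le c(1)])
  have alim: "(\<lambda>k. axis_re (f (r k)) y w) \<longlonglongrightarrow> axis_re c' y w" for y w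
    by (rule axis_re_tendsto[OF degf degc' lim])
  have "(\<lambda>k. \<Sum>i\<le>n. \<bar>coeff (f (r k)) i\<bar>) \<longlonglongrightarrow> (\<Sum>i\<le>n. \<bar>coeff c' i\<bar>)"
    by (intro tendsto_intros lim) auto
  then have "(\<Sum>i\<le>n. \<bar>coeff c' i\<bar>) = 1" by (simp add: sum1 LIMSEQ_const_iff)
  then have "c' \<noteq> 0" by auto
  moreover have "coeff c' n \<ge> 0"
    by (rule LIMSEQ_le_const[OF lim[OF order_refl]]) (use c(2) N in \<open>auto simp: cf less_imp_le\<close>)
  moreover have "axis_re c' a w \<ge> 0" for w
    by (rule LIMSEQ_le_const[OF alim]) (use pos N in \<open>auto simp: f_def axis_re_smult_left less_imp_le\<close>)
  moreover have "axis_re c' (smult l b + smult (1 - l) a) w \<ge> 0" for w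
  proof -
    have lim_p: "(\<lambda>k. x (r k) * axis_re (f (r k)) b w + (1 - x (r k)) * axis_re (f (r k)) a w)
        \<longlonglongrightarrow> l * axis_re c' b w + (1 - l) * axis_re c' a w"
      using LIMSEQ_subseq_LIMSEQ[OF x r(1)] by (intro tendsto_intros alim) (simp_all add: o_def)
    have "x k * axis_re (f k) b w + (1 - x k) * axis_re (f k) a w \<ge> 0" for k
    proof -
      have "x k * axis_re (f k) b w + (1 - x k) * axis_re (f k) a w = inverse (N k) * axis_re (c k) (p k) w"
        by (simp add: f_def p axis_re_smult_left axis_re_smult_right axis_re_add_right algebra_simps)
      then show ?thesis using pos(2)[of k w] N[of k] by simp
    qed
    then have "l * axis_re c' b w + (1 - l) * axis_re c' a w \<ge> 0"
      by (intro LIMSEQ_le_const[OF lim_p]) auto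
    then show ?thesis by (simp add: axis_re_smult_right axis_re_add_right)
  qed
  ultimately show ?thesis using degc' by blast
qed

text \<open>Moving the parameter by \<open>u - l\<close> adds that multiple of \<open>b - a\<close>,
  and the perturbation bound is uniform in the frequency. It treats positive multiples only, so the
  two directions use \<open>b - a\<close> and \<open>a - b\<close>.\<close>

lemma segment_strict_open:
  assumes a: "degree a = n" "lead_coeff a = 1" and b: "degree b = n" "lead_coeff b = 1"
    and c: "degree c \<le> n" "coeff c n > 0" "\<And>w. axis_re c (smult l b + smult (1 - l) a) w > 0"
  shows "\<exists>e>0. \<forall>u. \<bar>u - l\<bar> < e \<longrightarrow> (\<forall>w. axis_re c (smult u b + smult (1 - u) a) w > 0)"
proof -
  define p where "p = smult l b + smult (1 - l) a"
  have degp: "degree p \<le> n" unfolding p_def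
    using a b by (intro degree_add_le order.trans[OF degree_smult_le]) auto
  have top: "coeff (axis_poly c p) (2 * n) > 0"
    using coeff_axis_poly_top[OF c(1) degp] c(2) a b by (simp add: p_def)
  have "\<exists>e0>0. \<forall>e. 0 < e \<and> e < e0 \<longrightarrow> coeff (axis_poly c p) (2 * n) + e * coeff (axis_poly c q) (2 * n) > 0 \<and>
      (\<forall>w. poly (axis_poly c p) w + e * poly (axis_poly c q) w > 0)"
    if "degree q \<le> n" for q
    using that degp c(1,3) top
    by (intro poly_perturbation_pos degree_axis_poly_le')
       (auto simp: poly_axis_poly less_imp_le p_def[symmetric] dest: less_imp_neq[THEN not_sym])
  note pert = this
  have pert': "\<exists>e0>0. \<forall>e. 0 < e \<and> e < e0 \<longrightarrow> (\<forall>w. axis_re c p w + e * axis_re c q w > 0)"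
    if "degree q \<le> n" for q
    using pert[OF that] unfolding poly_axis_poly by auto
  have deg: "degree (b - a) \<le> n" "degree (a - b) \<le> n"
    using a b by (auto intro!: degree_diff_le)
  obtain e1 where e1: "e1 > 0"
    "\<And>e w. 0 < e \<Longrightarrow> e < e1 \<Longrightarrow> axis_re c p w + e * axis_re c (b - a) w > 0"
    using pert'[OF deg(1)] by auto
  obtain e2 where e2: "e2 > 0"
    "\<And>e w. 0 < e \<Longrightarrow> e < e2 \<Longrightarrow> axis_re c p w + e * axis_re c (a - b) w > 0"
    using pert'[OF deg(2)] by auto
  have "axis_re c (smult u b + smult (1 - u) a) w > 0" if u: "\<bar>u - l\<bar> < min e1 e2" for u w
  proof -
    have "smult u b + smult (1 - u) a = p + smult (u - l) (b - a)"
      by (simp add: p_def poly_eq_iff algebra_simps)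
    then have eq1: "axis_re c (smult u b + smult (1 - u) a) w =
        axis_re c p w + (u - l) * axis_re c (b - a) w"
      by (simp only: axis_re_add_right axis_re_smult_right)
    have "smult u b + smult (1 - u) a = p + smult (l - u) (a - b)"
      by (simp add: p_def poly_eq_iff algebra_simps)
    then have eq2: "axis_re c (smult u b + smult (1 - u) a) w =
        axis_re c p w + (l - u) * axis_re c (a - b) w"
      by (simp only: axis_re_add_right axis_re_smult_right)
    show ?thesis
    proof (cases u l rule: linorder_cases)
      case less
      then show ?thesis using e2(2)[of "l - u" w] u unfolding eq2 by auto
    next
      case equal
      then show ?thesis using c(3) by simp
    next
      case greater
      then show ?thesis using e1(2)[of "u - l" w] u unfolding eq1 by auto
    qed
  qed
  then show ?thesis using e1(1) e2(1) by (intro exI[of _ "min e1 e2"]) auto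
qed

lemma segment_stable_imp_common_spr:
  assumes a: "degree a = n" "lead_coeff a = 1" and b: "degree b = n" "lead_coeff b = 1"
    and st: "\<And>t. 0 \<le> t \<Longrightarrow> t \<le> 1 \<Longrightarrow> hurwitz_stable (smult t b + smult (1 - t) a)"
  shows "\<exists>c. degree c = n \<and> (\<forall>w. axis_re c a w > 0 \<and> axis_re c b w > 0)"
proof -
  define B where "B l = smult l b + smult (1 - l) a" for l
  have aH: "hurwitz_stable a" using st[of 0] by simp
  have degB: "degree (B l) = n" "lead_coeff (B l) = 1" for l
  proof -
    have "degree (B l) \<le> n" unfolding B_def
      using a b by (intro degree_add_le order.trans[OF degree_smult_le]) auto
    moreover have "coeff (B l) n = 1" using a b by (simp add: B_def)
    ultimately show "degree (B l) = n" by (metis le_antisym le_degree zero_neq_one)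
    then show "lead_coeff (B l) = 1" using \<open>coeff (B l) n = 1\<close> by simp
  qed
  \<comment> \<open>The condition at \<open>n\<close> forces degree exactly \<open>n\<close> and
    keeps positivity at infinite frequency for the openness step.\<close>
  define good where "good l c \<longleftrightarrow> degree c \<le> n \<and> coeff c n > 0 \<and>
    (\<forall>w. axis_re c a w > 0) \<and> (\<forall>w. axis_re c (B l) w > 0)" for l c
  define S where "S = {l \<in> {0..1}. \<exists>c. good l c}"
  have "closed S"
  proof (subst closed_sequential_limits, intro allI impI, elim conjE)
    fix x :: "nat \<Rightarrow> real" and l assume x: "\<forall>m. x m \<in> S" and l: "x \<longlonglongrightarrow> l"
    have l01: "l \<in> {0..1}"
      using closed_sequentially[of "{0..1::real}" x l] x l by (auto simp: S_def)
    have "\<forall>k. \<exists>c. good (x k) c" using x by (simp add: S_def)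
    then obtain c where c: "\<And>k. good (x k) (c k)" by metis
    have ck: "degree (c k) \<le> n" "coeff (c k) n > 0" "axis_re (c k) a w > 0"
      "axis_re (c k) (B (x k)) w > 0" for k w
      using c[of k] by (auto simp: good_def)
    have "\<exists>c'. c' \<noteq> 0 \<and> degree c' \<le> n \<and> coeff c' n \<ge> 0 \<and> (\<forall>w. axis_re c' a w \<ge> 0) \<and>
        (\<forall>w. axis_re c' (B l) w \<ge> 0)"
      unfolding B_def[of l] by (rule weak_limit_exists[OF ck B_def l])
    then obtain c' where c': "c' \<noteq> 0" "degree c' \<le> n" "coeff c' n \<ge> 0"
      "\<And>w. axis_re c' a w \<ge> 0" "\<And>w. axis_re c' (B l) w \<ge> 0"
      by blast
    have Bl: "hurwitz_stable (B l)" unfolding B_def using l01 by (intro st) auto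
    have "ceval (B l) (\<i> * of_real w) / ceval a (\<i> * of_real w) \<notin> \<real>\<^sub>\<le>\<^sub>0" for w
      unfolding B_def using l01 by (intro segment_axis_ratio_not_nonpos st aH) auto
    from common_spr_weak_imp_strict[OF aH a Bl degB this c'] have "\<exists>c. good l c"
      unfolding good_def by blast
    then show "l \<in> S" using l01 by (simp add: S_def)
  qed
  then have cl: "closedin (top_of_set {0..1}) S"
    by (intro closed_subset) (auto simp: S_def)
  have op: "openin (top_of_set {0..1}) S"
    unfolding openin_contains_ball
  proof (intro conjI ballI)
    show "S \<subseteq> {0..1}" by (auto simp: S_def)
    fix l assume "l \<in> S"
    then obtain c where c: "good l c" by (auto simp: S_def)
    have "\<exists>e>0. \<forall>u. \<bar>u - l\<bar> < e \<longrightarrow> (\<forall>w. axis_re c (B u) w > 0)"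
      unfolding B_def by (rule segment_strict_open[OF a b]) (use c in \<open>auto simp: good_def B_def\<close>)
    then obtain e where e: "e > 0" "\<And>u. \<bar>u - l\<bar> < e \<Longrightarrow> \<forall>w. axis_re c (B u) w > 0"
      by blast
    have "u \<in> S" if "u \<in> ball l e \<inter> {0..1}" for u
      using that c e(2)[of u] by (auto simp: S_def good_def dist_real_def abs_minus_commute)
    then show "\<exists>e>0. ball l e \<inter> {0..1} \<subseteq> S" using e(1) by blast
  qed
  have "connected {0..1::real}" by simp
  then have "S = {} \<or> S = {0..1}" using op cl unfolding connected_clopen by blast
  moreover have "good 0 a"
  proof -
    have "axis_re a a w > 0" for w
    proof -
      have "ceval a (\<i> * of_real w) \<noteq> 0"
        using aH by (auto simp: hurwitz_stable_ceval dest!: spec[of _ "\<i> * of_real w"])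
      moreover have "axis_re a a w = (norm (ceval a (\<i> * of_real w)))\<^sup>2"
        unfolding axis_re_def by (metis Re_complex_of_real complex_norm_square)
      ultimately show ?thesis by simp
    qed
    then show ?thesis using a by (simp add: good_def B_def)
  qed
  then have "0 \<in> S" by (auto simp: S_def)
  ultimately have "1 \<in> S" by auto
  then obtain c where c: "good 1 c" by (auto simp: S_def)
  then have "degree c = n" unfolding good_def by (metis le_antisym le_degree less_irrefl)
  then show ?thesis using c by (auto simp: good_def B_def)
qed

theorem theorem1:
  fixes a b :: "real poly" and n :: nat
  assumes "n \<ge> 1"
    and "degree a = n" and "lead_coeff a = 1"
    and "degree b = n" and "lead_coeff b = 1"
    and "hurwitz_stable a" and "hurwitz_stable b"
  shows "(\<exists>c :: real poly. SPR c a \<and> SPR c b) \<longleftrightarrow>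
         (\<forall>l::real. 0 \<le> l \<and> l \<le> 1 \<longrightarrow>
            hurwitz_stable (smult l b + smult (1 - l) a) \<and>
            degree (smult l b + smult (1 - l) a) = n)"
proof
  assume "\<exists>c. SPR c a \<and> SPR c b"
  then obtain c where c: "\<And>w. axis_re c a w > 0" "\<And>w. axis_re c b w > 0"
    by (auto simp: SPR_axis_re)
  have "degree (smult l b + smult (1 - l) a) = n" for l
  proof (rule antisym)
    show "degree (smult l b + smult (1 - l) a) \<le> n"
      using assms by (intro degree_add_le order.trans[OF degree_smult_le]) auto
    show "n \<le> degree (smult l b + smult (1 - l) a)"
      using assms by (intro le_degree) simp
  qed
  then show "\<forall>l. 0 \<le> l \<and> l \<le> 1 \<longrightarrow> hurwitz_stable (smult l b + smult (1 - l) a) \<and>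
      degree (smult l b + smult (1 - l) a) = n"
    using spr_common_imp_segment_stable[OF assms(2,3,6,4,5) c] by blast
next
  assume "\<forall>l. 0 \<le> l \<and> l \<le> 1 \<longrightarrow> hurwitz_stable (smult l b + smult (1 - l) a) \<and>
      degree (smult l b + smult (1 - l) a) = n"
  then obtain c where "degree c = n" "\<And>w. axis_re c a w > 0" "\<And>w. axis_re c b w > 0"
    using segment_stable_imp_common_spr[OF assms(2-5)] by blast
  then have "SPR c a \<and> SPR c b" using assms by (simp add: SPR_axis_re)
  then show "\<exists>c. SPR c a \<and> SPR c b" ..
qed

end
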